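(* Let $L$ be a multiset of even integers greater than $2$, and set $\epsilon=(2|L|+1)(\max(L)+3)$. Then there is a $\mathcal{GL}(x,y)$ of $\left[L,2\ \middle|\ \epsilon-\sum_{\ell\in L}\ell-2\right]$, where $x=\frac{\max(L)}{2}+1$ and $y=(|L|+1)(\max(L)+3)-1$.
   Context: $\mathcal{I}(a,b)=\{x\in\mathbb{Z}\mid a\le x\le b\}$; $|L|$ counts multiplicity; the maximum of an empty multiset is $0$. For a multiset $L$ of integers $\ge 2$ and $m\ge 0$, $[L\mid m]$ is the vertex-disjoint union of one $\ell$-cycle for each $\ell\in L$ (a $2$-cycle being two vertices joined by two parallel edges) and a path with $m$ edges; $[L,2\mid m]$ means $L$ with one extra $2$ added. Its number of edges is $\epsilon=\sum\ell+m$. A labeling is an isomorphic copy with distinct integer vertices; $\Delta\Gamma$ is the multiset of differences $x-y$ over ordered pairs of adjacent vertices (parallel edges counted separately). A $\mathcal{GL}(x,y)$ (graceful labeling with path ends $x,y$) of such a graph with $\epsilon$ edges and at most one $2$-cycle is a labeling $\Gamma$ with vertex set $\mathcal{I}(0,\epsilon)$, path end-vertices $x$ and $y$, and $\Delta\Gamma=\pm\mathcal{I}(1,\epsilon)$ if there is no $2$-cycle, $\Delta\Gamma=\pm\{1,3,3\}\cup\pm\mathcal{I}(4,\epsilon)$ (as multisets) if there is exactly one $2$-cycle. *)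

theory Defs
  imports Complex_Main "HOL-Library.Multiset"
begin

text \<open>Finite undirected multigraphs without loops: an edge is the two-element set of its
  end-vertices, and parallel edges are recorded by multiplicity.\<close>

record 'v multigraph =
  verts :: "'v set"
  edges :: "'v set multiset"

definition multigraph_iso :: "('v \<Rightarrow> 'w) \<Rightarrow> 'v multigraph \<Rightarrow> 'w multigraph \<Rightarrow> bool" where
  "multigraph_iso f G H \<longleftrightarrow>
     bij_betw f (verts G) (verts H) \<and> edges H = image_mset (image f) (edges G)"

text \<open>Only used for \<open>n \<ge> 2\<close>; for \<open>n = 2\<close> the edge \<open>{0, 1}\<close> has multiplicity two.\<close>

definition cycle_graph :: "nat \<Rightarrow> nat multigraph" where
  "cycle_graph n =
     \<lparr> verts = {0..<n}, edges = image_mset (\<lambda>i. {i, Suc i mod n}) (mset_set {0..<n}) \<rparr>"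

definition path_graph :: "nat \<Rightarrow> nat multigraph" where
  "path_graph m =
     \<lparr> verts = {0..m}, edges = image_mset (\<lambda>i. {i, Suc i}) (mset_set {0..<m}) \<rparr>"

definition disjoint_union_graph :: "'i set \<Rightarrow> ('i \<Rightarrow> 'v multigraph) \<Rightarrow> ('i \<times> 'v) multigraph" where
  "disjoint_union_graph I G =
     \<lparr> verts = (SIGMA i:I. verts (G i)),
       edges = (\<Sum>i\<in>I. image_mset (image (Pair i)) (edges (G i))) \<rparr>"

text \<open>The graph \<open>[L | m]\<close>. The component with index \<open>Some (l, k)\<close>, where \<open>k < count L l\<close>, is the
  \<open>k\<close>-th of the cycles of length \<open>l\<close>; the component with index \<open>None\<close> is the path, whose
  end-vertices are \<open>(None, 0)\<close> and \<open>(None, m)\<close>.\<close>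

definition cycles_path :: "nat multiset \<Rightarrow> nat \<Rightarrow> ((nat \<times> nat) option \<times> nat) multigraph" where
  "cycles_path L m =
     disjoint_union_graph
       (insert None (Some ` (SIGMA l:set_mset L. {0..<count L l})))
       (\<lambda>i. case i of None \<Rightarrow> path_graph m | Some (l, k) \<Rightarrow> cycle_graph l)"

text \<open>The multiset of differences over all ordered pairs of adjacent vertices: an edge with
  end-vertices \<open>a \<noteq> b\<close> contributes \<open>a - b\<close> and \<open>b - a\<close>, as often as its multiplicity.\<close>

definition differences :: "int multigraph \<Rightarrow> int multiset" where
  "differences \<Gamma> =
     (\<Sum>e\<in>#edges \<Gamma>. image_mset (\<lambda>(a, b). a - b) (mset_set {(a, b). e = {a, b}}))"

definition plus_minus :: "int multiset \<Rightarrow> int multiset" where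
  "plus_minus M = M + image_mset uminus M"

definition graceful_labeling :: "nat multiset \<Rightarrow> nat \<Rightarrow> int \<Rightarrow> int \<Rightarrow> int multigraph \<Rightarrow> bool" where
  "graceful_labeling L m x y \<Gamma> \<longleftrightarrow>
     (\<forall>l\<in>#L. 2 \<le> l) \<and> count L 2 \<le> 1 \<and>
     (\<exists>f. multigraph_iso f (cycles_path L m) \<Gamma> \<and> f (None, 0) = x \<and> f (None, m) = y) \<and>
     (let \<epsilon> = int (size (edges (cycles_path L m))) in
        verts \<Gamma> = {0..\<epsilon>} \<and>
        differences \<Gamma> =
          (if count L 2 = 0 then plus_minus (mset_set {1..\<epsilon>})
           else plus_minus {#1, 3, 3#} + plus_minus (mset_set {4..\<epsilon>})))"

text \<open>The maximum of the empty multiset is \<open>0\<close>.\<close>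

definition max_mset :: "nat multiset \<Rightarrow> nat" where
  "max_mset L = (if L = {#} then 0 else Max (set_mset L))"

lemma sum_mset_count: "\<Sum>\<^sub># L = (\<Sum>l\<in>set_mset L. count L l * l)" for L :: "nat multiset"
proof (induction L)
  case (add x L)
  have "(\<Sum>l\<in>set_mset (add_mset x L). count (add_mset x L) l * l)
      = (\<Sum>l\<in>insert x (set_mset L). count L l * l + (if l = x then l else 0))"
    by (intro sum.cong) auto
  also have "\<dots> = (\<Sum>l\<in>insert x (set_mset L). count L l * l) + x"
    by (subst sum.distrib) (simp add: sum.delta)
  also have "(\<Sum>l\<in>insert x (set_mset L). count L l * l) = (\<Sum>l\<in>set_mset L. count L l * l)"
    by (rule sum.mono_neutral_right) (auto simp: not_in_iff)
  finally show ?case using add by simp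
qed simp

lemma size_edges_cycles_path: "size (edges (cycles_path L m)) = \<Sum>\<^sub># L + m"
proof -
  let ?S = "SIGMA l:set_mset L. {0..<count L l}"
  have fin: "finite ?S" by simp
  have "size (edges (cycles_path L m))
      = m + (\<Sum>i\<in>Some ` ?S. size (edges (case i of None \<Rightarrow> path_graph m | Some (l, k) \<Rightarrow> cycle_graph l)))"
    using fin
    by (simp add: cycles_path_def disjoint_union_graph_def path_graph_def size_multiset_sum
        image_iff)
  also have "(\<Sum>i\<in>Some ` ?S. size (edges (case i of None \<Rightarrow> path_graph m | Some (l, k) \<Rightarrow> cycle_graph l)))
      = (\<Sum>(l, k)\<in>?S. l)"
    by (subst sum.reindex) (auto simp: cycle_graph_def intro!: sum.cong)
  also have "\<dots> = (\<Sum>l\<in>set_mset L. \<Sum>k\<in>{0..<count L l}. l)"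
    by (subst sum.Sigma) auto
  also have "\<dots> = \<Sum>\<^sub># L"
    by (simp add: sum_mset_count)
  finally show ?thesis by simp
qed

lemma sum_mset_le_size_times_max: "\<Sum>\<^sub># L \<le> size L * max_mset L"
proof -
  have "\<Sum>\<^sub># L \<le> (\<Sum>l\<in>#L. max_mset L)"
    using sum_mset_mono[of L "\<lambda>l. l" "\<lambda>_. max_mset L"] by (auto simp: max_mset_def)
  then show ?thesis by simp
qed

text \<open>Hence a path length \<open>\<epsilon> - \<Sum>\<^sub># L - 2\<close> with \<open>\<epsilon> = (2 * size L + 1) * (max_mset L + 3)\<close> is never
  truncated by subtraction on natural numbers.\<close>

lemma path_length_positive:
  "\<Sum>\<^sub># L + 2 < (2 * size L + 1) * (max_mset L + 3)"
  using sum_mset_le_size_times_max[of L] by (simp add: algebra_simps)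

end

theory Submission
  imports Defs
begin

text \<open>Put \<open>K = max L / 2 + 1\<close>, so that \<open>max L + 3 = 2 * K + 1\<close>. The
  labeling is nested. Each cycle of length \<open>2 * j\<close> lives, together with a segment of
  the path, on the \<open>2 * K + 1\<close> smallest and the \<open>2 * K + 1\<close> largest labels
  that are left, joins only small labels to large ones, and uses up the \<open>4 * K + 1\<close>
  largest differences. Its path segment starts at the offset \<open>K\<close> from the left and ends
  at the offset \<open>K\<close> from the right, so the next difference leads to the offset
  \<open>K\<close> of the remaining interval and the construction repeats. The innermost part is a
  labeling of a 2-cycle and a path on \<open>{0..2 * K + 1}\<close>.

  A block is a balanced bipartite problem on two copies of \<open>{- K..K}\<close>, in which the
  edge labels \<open>a + b\<close> run once through \<open>{- 2 * K..2 * K}\<close>. Paths spanning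
  two intervals with consecutive labels exist for (almost) every end-vertex, by Euclid's algorithm;
  each block is assembled from a few of them.\<close>

section \<open>Bipartite paths with consecutive edge sums\<close>

type_synonym bivertex = "bool \<times> int"

definition steps :: "'a list \<Rightarrow> ('a \<times> 'a) list" where
  "steps p = zip p (tl p)"

lemma steps_simps [simp]:
  "steps [] = []" "steps [x] = []" "steps (x # y # p) = (x, y) # steps (y # p)"
  by (simp_all add: steps_def)

lemma steps_append:
  "p \<noteq> [] \<Longrightarrow> q \<noteq> [] \<Longrightarrow> steps (p @ q) = steps p @ (last p,
    hd q) # steps q"
proof (induction p rule: induct_list012)
  case (2 x)
  then show ?case by (cases q) auto
next
  case (3 x y p)
  then show ?case by simp
qed simp

lemma steps_map: "steps (map f p) = map (map_prod f f) (steps p)"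
  by (induction p rule: induct_list012) auto

lemma steps_rev: "steps (rev p) = rev (map prod.swap (steps p))"
proof (induction p rule: induct_list012)
  case (3 x y p)
  have "steps (rev (x # y # p)) = steps (rev (y # p) @ [x])" by simp
  also have "\<dots> = steps (rev (y # p)) @ [(last (rev (y # p)), x)]"
    by (subst steps_append) auto
  also have "last (rev (y # p)) = y" by (simp only: last_rev list.sel(1) list.discI)
  finally show ?case using 3 by simp
qed simp_all

lemma set_steps: "(u, v) \<in> set (steps p) \<Longrightarrow> u \<in> set p \<and> v \<in> set p"
  by (induction p rule: induct_list012) auto

definition step_sums :: "bivertex list \<Rightarrow> int list" where
  "step_sums p = map (\<lambda>(u, v). snd u + snd v) (steps p)"

definition bipartite_steps :: "bivertex list \<Rightarrow> bool" where
  "bipartite_steps p \<longleftrightarrow> (\<forall>(u, v)\<in>set (steps p). fst u \<noteq> fst v)"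

definition vertex_set :: "int set \<Rightarrow> int set \<Rightarrow> bivertex set" where
  "vertex_set A B = {True} \<times> A \<union> {False} \<times> B"

text \<open>Vertices with first component \<open>True\<close> form the left class. The label of an
  edge is the sum of its ends; in a graceful labeling the right class is later reversed, turning
  sums into differences.\<close>

definition piece :: "bivertex \<Rightarrow> bivertex \<Rightarrow> int set \<Rightarrow> int set
  \<Rightarrow> int set \<Rightarrow> bool" where
  "piece u v A B S \<longleftrightarrow> (\<exists>p. p \<noteq> [] \<and> hd p = u \<and> last p = v
    \<and> distinct p \<and> set p = vertex_set A B \<and>
     bipartite_steps p \<and> distinct (step_sums p) \<and> set (step_sums p) = S)"

lemma pieceE:
  assumes "piece u v A B S"
  obtains p where "p \<noteq> []" "hd p = u" "last p = v" "distinct p" "set p = vertex_set A B"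
     "bipartite_steps p" "distinct (step_sums p)" "set (step_sums p) = S"
  using assms unfolding piece_def by blast

lemma piece_single: "piece (True, x) (True, x) {x} {} {}" "piece (False, x) (False, x) {} {x} {}"
  by (auto simp: piece_def vertex_set_def step_sums_def bipartite_steps_def intro: exI[of _ "[(_, x)]"])

text \<open>The joining edge has the label \<open>x + y\<close>. The side conditions are elementwise
  rather than set equations, so that for intervals with a few points added or removed they unfold by
  \<open>interval_iffs\<close> to linear arithmetic.\<close>

lemma piece_join:
  assumes "s \<noteq> s'" "piece u (s, x) A B S" "piece (s', y) v A' B' S'"
    and A: "\<And>z. z \<in> A'' \<longleftrightarrow> z \<in> A \<or> z \<in> A'" "\<And>z. z \<in> A
      \<Longrightarrow> z \<notin> A'"
    and B: "\<And>z. z \<in> B'' \<longleftrightarrow> z \<in> B \<or> z \<in> B'" "\<And>z. z \<in> B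
      \<Longrightarrow> z \<notin> B'"
    and S: "\<And>z. z \<in> S'' \<longleftrightarrow> z = x + y \<or> z \<in> S \<or> z \<in> S'"
      "\<And>z. z \<in> S \<Longrightarrow> z \<notin> S'"
      "x + y \<notin> S" "x + y \<notin> S'"
  shows "piece u v A'' B'' S''"
proof -
  obtain p where p: "p \<noteq> []" "hd p = u" "last p = (s, x)" "distinct p" "set p = vertex_set A B"
     "bipartite_steps p" "distinct (step_sums p)" "set (step_sums p) = S"
    by (rule pieceE[OF assms(2)])
  obtain q where q: "q \<noteq> []" "hd q = (s', y)" "last q = v" "distinct q" "set q = vertex_set A' B'"
     "bipartite_steps q" "distinct (step_sums q)" "set (step_sums q) = S'"
    by (rule pieceE[OF assms(3)])
  have sums: "step_sums (p @ q) = step_sums p @ (x + y) # step_sums q"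
    using p q by (simp add: step_sums_def steps_append)
  have sets: "A'' = A \<union> A'" "B'' = B \<union> B'" "S'' = insert (x + y) (S \<union> S')"
    "A \<inter> A' = {}" "B \<inter> B' = {}" "S \<inter> S' = {}"
    using A B S by blast+
  have "p @ q \<noteq> [] \<and> hd (p @ q) = u \<and> last (p @ q) = v \<and> distinct (p @ q) \<and>
      set (p @ q) = vertex_set A'' B'' \<and> bipartite_steps (p @ q) \<and>
      distinct (step_sums (p @ q)) \<and> set (step_sums (p @ q)) = S''"
    unfolding sums using p q assms(1) S(3,4) sets
    by (auto simp: vertex_set_def bipartite_steps_def steps_append)
  then show ?thesis unfolding piece_def by blast
qed

lemmas piece_LR = piece_join[OF True_not_False]
lemmas piece_RL = piece_join[OF False_not_True]
lemmas interval_iffs = atLeastAtMost_iff Un_iff insert_iff Diff_iff empty_iff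

lemma piece_rev: "piece u v A B S \<Longrightarrow> piece v u A B S"
proof -
  assume "piece u v A B S"
  then obtain p where p: "p \<noteq> []" "hd p = u" "last p = v" "distinct p" "set p = vertex_set A B"
     "bipartite_steps p" "distinct (step_sums p)" "set (step_sums p) = S"
    unfolding piece_def by blast
  have "step_sums (rev p) = rev (step_sums p)"
    by (simp add: step_sums_def steps_rev rev_map case_prod_unfold comp_def add.commute)
  then show ?thesis unfolding piece_def using p
    by (intro exI[of _ "rev p"]) (auto simp: bipartite_steps_def steps_rev hd_rev last_rev)
qed

text \<open>Serves two symmetries: exchange of the classes, which keeps the sums, and negation of
  all labels, which negates them.\<close>

lemma piece_map:
  assumes "piece u v A B S" "inj g" "inj f" "g ` vertex_set A B = vertex_set A' B'"
    and g: "\<And>u v. fst u \<noteq> fst v \<Longrightarrow> fst (g u) \<noteq> fst (g v) \<and> snd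
      (g u) + snd (g v) = f (snd u + snd v)"
  shows "piece (g u) (g v) A' B' (f ` S)"
proof -
  obtain p where p: "p \<noteq> []" "hd p = u" "last p = v" "distinct p" "set p = vertex_set A B"
     "bipartite_steps p" "distinct (step_sums p)" "set (step_sums p) = S"
    by (rule pieceE[OF assms(1)])
  have *: "fst (g u) \<noteq> fst (g v) \<and> snd (g u) + snd (g v) = f (snd u + snd v)"
    if "(u, v) \<in> set (steps p)" for u v
    using that p(6) g[of u v] by (auto simp: bipartite_steps_def)
  have sums: "step_sums (map g p) = map f (step_sums p)"
    using * by (auto simp: step_sums_def steps_map)
  have bip: "bipartite_steps (map g p)"
    using * by (fastforce simp: bipartite_steps_def steps_map)
  have "distinct (map g p)" "distinct (map f (step_sums p))"
    using p assms(2,3) by (auto simp: distinct_map intro: inj_on_subset)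
  then show ?thesis
    unfolding piece_def using p assms(4) sums bip
    by (intro exI[of _ "map g p"]) (simp add: hd_map last_map)
qed

lemma piece_flip:
  assumes "piece (s, x) (s', y) A B S"
  shows "piece (\<not> s, x) (\<not> s', y) B A S"
proof -
  have *: "(\<lambda>u. (\<not> fst u, snd u)) ` vertex_set A B = vertex_set B A"
    by (force simp: vertex_set_def image_iff)
  show ?thesis
    using piece_map[OF assms _ _ *, of id] by (auto simp: inj_def prod_eq_iff)
qed

lemma piece_uminus:
  assumes "piece (s, x) (s', y) A B S"
  shows "piece (s, - x) (s', - y) (uminus ` A) (uminus ` B) (uminus ` S)"
proof -
  have *: "(\<lambda>u. (fst u, - snd u)) ` vertex_set A B = vertex_set (uminus ` A) (uminus ` B)"
    by (force simp: vertex_set_def)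
  show ?thesis
    using piece_map[OF assms _ _ *, of uminus] by (auto simp: inj_def prod_eq_iff)
qed

section \<open>Zigzags, and spanning paths of two intervals with prescribed ends\<close>

text \<open>The path \<open>a, b, a + 1, b + 1, ...\<close> replaces one end by its successor at
  each step, so its sums are consecutive.\<close>

lemma piece_zigzag_nat:
  "piece (True, a) (True, a + int m) {a..a + int m} {b..b + int m - 1} {a + b..a + b + 2 * int m - 1}"
proof (induction m)
  case 0
  show ?case using piece_single(1)[of a] by simp
next
  case (Suc m)
  have "piece (True, a) (False, b + int m) {a..a + int m} {b..b + int m} {a + b..a + b + 2 * int m}"
    by (rule piece_LR[OF Suc piece_single(2)]; simp only: interval_iffs; arith)
  from this piece_single(1)[of "a + int (Suc m)"] show ?case
    by (rule piece_RL; simp only: interval_iffs of_nat_Suc; arith)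
qed

lemma piece_zigzag_odd:
  assumes "a0 \<le> a1" "b1 - b0 = a1 - a0 - 1"
  shows "piece (True, a0) (True, a1) {a0..a1} {b0..b1} {a0 + b0..a1 + b1}"
proof -
  have "a0 + int (nat (a1 - a0)) = a1" "b0 + int (nat (a1 - a0)) - 1 = b1"
    "a0 + b0 + 2 * int (nat (a1 - a0)) - 1 = a1 + b1"
    using assms by auto
  then show ?thesis
    using piece_zigzag_nat[of a0 "nat (a1 - a0)" b0] by (simp only:)
qed

lemma piece_zigzag_even:
  assumes "a0 \<le> a1" "b1 - b0 = a1 - a0"
  shows "piece (True, a0) (False, b1) {a0..a1} {b0..b1} {a0 + b0..a1 + b1}"
proof -
  have "piece (True, a0) (True, a1) {a0..a1} {b0..b1 - 1} {a0 + b0..a1 + b1 - 1}"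
    using piece_zigzag_odd[of a0 a1 "b1 - 1" b0] assms by (simp add: algebra_simps)
  then show ?thesis
    by (rule piece_LR[OF _ piece_single(2)]; unfold interval_iffs; use assms in smt)
qed

lemma piece_zigzag_odd':
  assumes "b0 \<le> b1" "a1 - a0 = b1 - b0 - 1"
  shows "piece (False, b0) (False, b1) {a0..a1} {b0..b1} {b0 + a0..b1 + a1}"
  using piece_flip[OF piece_zigzag_odd[OF assms]] by simp

lemma piece_zigzag_even':
  assumes "b0 \<le> b1" "a1 - a0 = b1 - b0"
  shows "piece (False, b0) (True, a1) {a0..a1} {b0..b1} {b0 + a0..b1 + a1}"
  using piece_flip[OF piece_zigzag_even[OF assms]] by simp

text \<open>The labels of the end-vertices behave like a pair in Euclid's algorithm: if the offsets
  of the start from the two ends of its class are \<open>x < y\<close>, a zigzag over the \<open>x +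
  1\<close> smallest labels of each class leaves the offsets \<open>x\<close> and \<open>y - x -
  1\<close>. The case \<open>x = y\<close> is solved by a spiral.\<close>

lemma piece_square:
  assumes "a0 \<le> u" "u \<le> a1" "b1 - b0 = a1 - a0" "(u - a0) + (v - b0) = a1 - a0"
  shows "piece (True, u) (False, v) {a0..a1} {b0..b1} {a0 + b0..a1 + b1}"
  using assms
proof (induction "nat (a1 - a0)" arbitrary: a0 a1 b0 b1 u v rule: less_induct)
  case less
  have *: "piece (True, u) (False, v) {c0..c1} {d0..d1} {c0 + d0..c1 + d1}"
    if "c0 \<le> u" "d1 - d0 = c1 - c0" "(u - c0) + (v - d0) = c1 - c0" "2 * (u - c0) \<le> c1 - c0"
      "c1 - c0 = a1 - a0" for c0 c1 d0 d1 u v :: int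
  proof (cases "2 * (u - c0) = c1 - c0")
    case True
    \<comment> \<open>The two zigzags together miss only the label \<open>u + v\<close>. The jump
      from the left vertex \<open>c1\<close> to the right vertex \<open>d0\<close> supplies it, as
      \<open>c1 + d0 = u + v\<close>.\<close>
    have 1: "piece (True, u) (True, c1) {u..c1} {v + 1..d1} {u + (v + 1)..c1 + d1}"
      by (rule piece_zigzag_odd; use that True in smt)
    have 2: "piece (False, d0) (False, v) {c0..u - 1} {d0..v} {d0 + c0..v + (u - 1)}"
      by (rule piece_zigzag_odd'; use that(1-3) True in smt)
    show ?thesis
      by (rule piece_LR[OF 1 2]; unfold interval_iffs; use that True in smt)
  next
    case False
    define x where "x = u - c0"
    have 1: "piece (True, u) (False, d0) {c0..u} {d0..d0 + x} {d0 + c0..d0 + x + u}"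
      by (rule piece_rev, rule piece_zigzag_even'; use that(1) x_def in smt)
    have 2: "piece (True, u + 1 + x) (False, v) {u + 1..c1} {d0 + x + 1..d1} {u + 1 + (d0 + x + 1)..c1 + d1}"
      by (rule less(1); use that False in \<open>linarith | simp add: x_def\<close>)
    show ?thesis
      by (rule piece_RL[OF 1 2]; unfold interval_iffs; use that False x_def in smt)
  qed
  show ?case
  proof (cases "2 * (u - a0) \<le> a1 - a0")
    case True
    then show ?thesis using * less.prems by blast
  next
    case False
    \<comment> \<open>Negating all labels interchanges the two offsets of \<open>u\<close>, so the
      case already treated applies.\<close>
    have "piece (True, - u) (False, - v) {- a1..- a0} {- b1..- b0} {- a1 + - b1..- a0 + - b0}"
      by (rule *) (use less.prems False in auto)
    from piece_uminus[OF this] show ?thesis by (simp add: algebra_simps)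
  qed
qed

text \<open>From the smaller end a zigzag goes down to \<open>a0\<close>, and what remains is a
  square. The ends can coincide only when the path is a single vertex.\<close>

lemma piece_rectangle:
  assumes "a0 \<le> u" "u \<le> a1" "b1 - b0 = a1 - a0 - 1" "(u - a0) + (v - a0) = a1 - a0"
    and "u \<noteq> v \<or> a0 = a1"
  shows "piece (True, u) (True, v) {a0..a1} {b0..b1} {a0 + b0..a1 + b1}"
proof -
  have *: "piece (True, u) (True, v) {a0..a1} {b0..b1} {a0 + b0..a1 + b1}"
    if "a0 \<le> u" "u < v" "(u - a0) + (v - a0) = a1 - a0" for u v
  proof -
    define x where "x = u - a0"
    have 1: "piece (True, u) (True, a0) {a0..u} {b0..b0 + x - 1} {a0 + b0..u + (b0 + x - 1)}"
      by (rule piece_rev, rule piece_zigzag_odd) (use that in \<open>auto simp: x_def\<close>)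
    have 2: "piece (False, b0 + 2 * x) (True, v) {u + 1..a1} {b0 + x..b1} {b0 + x + (u + 1)..b1 + a1}"
      using piece_flip[OF piece_square[of "b0 + x" "b0 + 2 * x" b1 a1 "u + 1" v]] that assms(3)
      by (simp add: x_def)
    show ?thesis
      by (rule piece_LR[OF 1 2]; unfold interval_iffs; use that assms(3) x_def in smt)
  qed
  consider "u < v" | "v < u" | "u = v" "a0 = a1" using assms(5) by linarith
  then show ?thesis
  proof cases
    case 1
    then show ?thesis using * assms by blast
  next
    case 2
    then show ?thesis using *[of v u] assms by (intro piece_rev[OF *]) auto
  next
    case 3
    then show ?thesis using piece_single(1)[of u] assms by simp
  qed
qed

lemma piece_square':
  assumes "b0 \<le> u" "u \<le> b1" "b1 - b0 = a1 - a0" "(u - b0) + (v - a0) = b1 - b0"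
  shows "piece (False, u) (True, v) {a0..a1} {b0..b1} {a0 + b0..a1 + b1}"
  using piece_flip[OF piece_square[of b0 u b1 a1 a0 v]] assms by (simp add: add.commute)

lemma piece_rectangle':
  assumes "b0 \<le> u" "u \<le> b1" "b1 - b0 - 1 = a1 - a0" "(u - b0) + (v - b0) = b1 - b0"
    and "u \<noteq> v \<or> b0 = b1"
  shows "piece (False, u) (False, v) {a0..a1} {b0..b1} {a0 + b0..a1 + b1}"
  using piece_flip[OF piece_rectangle[of b0 u b1 a1 a0 v]] assms by (simp add: add.commute)

section \<open>Blocks: a cycle and a path on two copies of an interval\<close>

text \<open>The cycle is a list whose closing edge is written separately and must change class too.
  The path joins the centres of the two classes, which later become the offsets \<open>K\<close>
  from the left and from the right.\<close>

definition graceful_block :: "int \<Rightarrow> nat \<Rightarrow> bool" where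
  "graceful_block K j \<longleftrightarrow> (\<exists>p c. p \<noteq> [] \<and> hd p = (True, 0) \<and>
    last p = (False, 0) \<and> c \<noteq> [] \<and>
     length c = 2 * j \<and> fst (hd c) \<noteq> fst (last c) \<and> bipartite_steps p \<and>
      bipartite_steps c \<and>
     distinct (p @ c) \<and> set (p @ c) = vertex_set {-K..K} {-K..K} \<and>
     distinct (step_sums p @ (snd (last c) + snd (hd c)) # step_sums c) \<and>
     set (step_sums p @ (snd (last c) + snd (hd c)) # step_sums c) = {-2 * K..2 * K})"

lemma alternating_balance:
  assumes "bipartite_steps p" "p \<noteq> []"
  shows "length (filter fst p) + of_bool (\<not> fst (hd p)) = length (filter (\<lambda>u. \<not> fst
    u) p) + of_bool (fst (last p))"
  using assms
proof (induction p rule: induct_list012)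
  case (3 u v p)
  then show ?case by (auto simp: bipartite_steps_def)
qed (auto simp: of_bool_def)

text \<open>An alternating path between different classes visits both equally often. Hence the
  length of a cycle can be read off from one class.\<close>

lemma piece_card:
  assumes "piece (True, x) (False, y) A B S"
  shows "card A = card B"
proof -
  obtain p where p: "p \<noteq> []" "hd p = (True, x)" "last p = (False, y)" "distinct p"
     "set p = vertex_set A B" "bipartite_steps p" "distinct (step_sums p)" "set (step_sums p) = S"
    by (rule pieceE[OF assms])
  have "set (filter fst p) = {True} \<times> A" "set (filter (\<lambda>u. \<not> fst u) p) = {False} \<times> B"
    unfolding set_filter p(5) vertex_set_def by auto
  moreover have "length q = card (set q)" if "distinct q" for q :: "bivertex list"
    using that by (simp add: distinct_card)
  ultimately have "length (filter fst p) = card ({True} \<times> A)"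
    "length (filter (\<lambda>u. \<not> fst u) p) = card ({False} \<times> B)"
    using p(4) by (metis distinct_filter)+
  then show ?thesis
    using alternating_balance[OF p(6,1)] p(2,3) by (simp add: card_cartesian_product)
qed

lemma graceful_blockI:
  assumes P: "piece (True, 0) (False, 0) A B S" and C: "piece (True, x) (False, y) A' B' S'"
    and card: "card A' = j \<or> card B' = j"
    and A: "\<And>z. z \<in> {-K..K} \<longleftrightarrow> z \<in> A \<or> z \<in> A'" "\<And>z. z
      \<in> A \<Longrightarrow> z \<notin> A'"
    and B: "\<And>z. z \<in> {-K..K} \<longleftrightarrow> z \<in> B \<or> z \<in> B'" "\<And>z. z
      \<in> B \<Longrightarrow> z \<notin> B'"
    and S: "\<And>z. z \<in> {-2 * K..2 * K} \<longleftrightarrow> z = x + y \<or> z \<in> S \<or> z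
      \<in> S'" "\<And>z. z \<in> S \<Longrightarrow> z \<notin> S'"
      "x + y \<notin> S" "x + y \<notin> S'"
  shows "graceful_block K j"
proof -
  obtain p where p: "p \<noteq> []" "hd p = (True, 0)" "last p = (False, 0)" "distinct p"
     "set p = vertex_set A B" "bipartite_steps p" "distinct (step_sums p)" "set (step_sums p) = S"
    by (rule pieceE[OF P])
  obtain c where c: "c \<noteq> []" "hd c = (True, x)" "last c = (False, y)" "distinct c"
     "set c = vertex_set A' B'" "bipartite_steps c" "distinct (step_sums c)" "set (step_sums c) = S'"
    by (rule pieceE[OF C])
  have sets: "{-K..K} = A \<union> A'" "{-K..K} = B \<union> B'" "A \<inter> A' = {}" "B \<inter> B' =
    {}" "S \<inter> S' = {}"
    "{-2 * K..2 * K} = insert (x + y) (S \<union> S')"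
    using A B S by blast+
  have fin: "finite A'" "finite B'"
    using sets(1,2) by (metis finite_Un finite_atLeastAtMost_int)+
  have len: "length c = 2 * j"
  proof -
    have "length c = card ({True} \<times> A' \<union> {False} \<times> B')"
      using c(4,5) by (metis distinct_card vertex_set_def)
    also have "\<dots> = card A' + card B'"
      using fin by (subst card_Un_disjoint) (auto simp: card_cartesian_product)
    finally show ?thesis using card piece_card[OF C] by auto
  qed
  have "set p \<inter> set c = {}"
    unfolding p(5) c(5) vertex_set_def using sets(3,4) by blast
  then have "distinct (p @ c)"
    using p(4) c(4) by simp
  moreover have "set (p @ c) = vertex_set {-K..K} {-K..K}"
  proof -
    have "set (p @ c) = vertex_set (A \<union> A') (B \<union> B')"
      unfolding set_append p(5) c(5) vertex_set_def by blast
    then show ?thesis by (simp only: sets(1,2)[symmetric])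
  qed
  moreover have "distinct (step_sums p @ (snd (last c) + snd (hd c)) # step_sums c)"
    using p(7,8) c(2,3,7,8) S(3,4) sets(5) by (simp add: add.commute)
  moreover have "set (step_sums p @ (snd (last c) + snd (hd c)) # step_sums c) = {-2 * K..2 * K}"
    unfolding sets(6) using p(8) c(2,3,8) by (simp add: add.commute)
  ultimately show ?thesis
    unfolding graceful_block_def using p c len by (intro exI[of _ p] exI[of _ c]) simp
qed

text \<open>Omitting the right vertex \<open>- s\<close> from this half of a spiral costs exactly
  the label \<open>- 2 * s\<close>, and this is the label of the edge by which a path coming from
  the right vertex \<open>K - 2 * s\<close> enters it.\<close>

lemma piece_outer:
  assumes "0 < s" "s < K"
  shows "piece (True, - K) (False, 0) {- K..- 1} ({- K..0} - {- s}) ({- 2 * K..- 1} - {- 2 * s})"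
proof -
  have 1: "piece (True, - K) (False, - s - 1) {- K..- s - 1} {- K..- s - 1} {- K + - K..- s - 1 + (- s - 1)}"
    by (rule piece_square; use assms in simp)
  have 2: "piece (True, - s) (False, 0) {- s..- 1} {- s + 1..0} {- s + (- s + 1)..- 1 + 0}"
    by (rule piece_square; use assms in simp)
  show ?thesis
    by (rule piece_RL[OF 1 2]; unfold interval_iffs; use assms in smt)
qed

text \<open>The edge from the right vertex \<open>K - 2 * s\<close> to the left vertex
  \<open>- K\<close> has the label \<open>- 2 * s\<close>, the one missing in
  \<open>piece_outer\<close>. So it remains to arrange the nonnegative labels; the right vertex
  \<open>- s\<close> is free for the path or for the cycle.\<close>

lemma piece_append_outer:
  assumes "piece (True, 0) (False, K - 2 * s) A B S" "0 < s" "s < K"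
    and "\<And>z. z \<in> A \<Longrightarrow> 0 \<le> z" "\<And>z. z \<in> B \<Longrightarrow> 0 < z
      \<or> z = - s" "\<And>z. z \<in> S \<Longrightarrow> 0 \<le> z"
    and "A' = A \<union> {- K..- 1}" "B' = B \<union> ({- K..0} - {- s})" "S' = S \<union> {- 2 * K..- 1}"
  shows "piece (True, 0) (False, 0) A' B' S'"
  unfolding assms(7-9)
  by (rule piece_RL[OF assms(1) piece_outer[OF assms(2,3)]]; use assms(2-6) in fastforce)

section \<open>Blocks whose cycle has \<open>2 * s + 1\<close> vertices in each class\<close>

text \<open>With \<open>r = K - 2 * s\<close>, the path gets the small nonnegative labels and the
  cycle the large ones. The right vertex \<open>- s\<close> closes the cycle through the left
  vertices \<open>s\<close> and \<open>s + 2 * r\<close>, with labels \<open>0\<close> and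
  \<open>2 * r\<close>. These lie in \<open>{r..K}\<close> because \<open>r \<le> s\<close>.\<close>

lemma graceful_block_odd_small:
  assumes "0 < s" "2 * s < K" "K \<le> 3 * s"
  shows "graceful_block K (nat (2 * s + 1))"
proof -
  define r where "r = K - 2 * s"
  have 1: "piece (True, 0) (False, K - 2 * s) {0..r - 1} {1..r} {0 + 1..r - 1 + r}"
    by (rule piece_square; use assms r_def in simp)
  have P: "piece (True, 0) (False, 0) ({0..r - 1} \<union> {- K..- 1}) ({1..r} \<union> ({- K..0} - {- s}))
    ({0 + 1..r - 1 + r} \<union> {- 2 * K..- 1})"
    by (rule piece_append_outer[OF 1]; use assms in simp)
  have 2: "piece (True, s) (True, s + 2 * r) {r..K} {r + 1..K} {r + (r + 1)..K + K}"
    by (rule piece_rectangle; use assms r_def in simp)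
  have C: "piece (True, s) (False, - s) {r..K} ({r + 1..K} \<union> {- s}) ({r + (r + 1)..K + K}
    \<union> {2 * r})"
    by (rule piece_LR[OF 2 piece_single(2)]; unfold interval_iffs; use assms r_def in smt)
  have "card {r..K} = nat (2 * s + 1)"
    using assms by (simp add: r_def)
  then show ?thesis
    by - (rule graceful_blockI[OF P C disjI1], assumption; unfold interval_iffs; use assms r_def in smt)
qed

text \<open>Now \<open>s < r\<close>, so the left vertex \<open>s\<close> is cut out of the path,
  which frees the label \<open>2 * s\<close>. The cycle passes \<open>s, - s, 3 * s\<close> with
  labels \<open>0\<close> and \<open>2 * s\<close>, continues on the labels above \<open>r\<close>,
  and closes with \<open>2 * r + 1\<close>.\<close>

lemma graceful_block_odd_medium:
  assumes "0 < s" "3 * s < K" "K < 5 * s"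
  shows "graceful_block K (nat (2 * s + 1))"
proof -
  define r where "r = K - 2 * s"
  have 1: "piece (True, 0) (False, s) {0..s - 1} {1..s} {0 + 1..s - 1 + s}"
    by (rule piece_square; use assms in simp)
  have 2: "piece (True, s + 1) (False, K - 2 * s) {s + 1..r} {s + 1..r} {s + 1 + (s + 1)..r + r}"
    by (rule piece_square; use assms r_def in simp)
  have 3: "piece (True, 0) (False, K - 2 * s) ({0..r} - {s}) {1..r} ({1..r + r} - {2 * s})"
    by (rule piece_RL[OF 1 2]; unfold interval_iffs; use assms r_def in smt)
  have P: "piece (True, 0) (False, 0) (({0..r} - {s}) \<union> {- K..- 1}) ({1..r} \<union> ({- K..0} - {- s}))
    (({1..r + r} - {2 * s}) \<union> {- 2 * K..- 1})"
    by (rule piece_append_outer[OF 3]; use assms in simp)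
  have 4: "piece (True, s) (False, - s) {s} {- s} {0}"
    by (rule piece_LR[OF piece_single]; simp)
  have 5: "piece (True, 3 * s) (False, 2 * r - s + 1) {r + 1..K} {r + 1..K} {r + 1 + (r + 1)..K + K}"
    by (rule piece_square; use assms r_def in simp)
  have C: "piece (True, s) (False, 2 * r - s + 1) ({s} \<union> {r + 1..K}) ({- s} \<union> {r + 1..K})
     ({0, 2 * s} \<union> {r + 1 + (r + 1)..K + K})"
    by (rule piece_RL[OF 4 5]; unfold interval_iffs; use assms r_def in smt)
  have "card ({s} \<union> {r + 1..K}) = nat (2 * s + 1)"
    using assms by (simp add: r_def)
  then show ?thesis
    by - (rule graceful_blockI[OF P C disjI1], assumption; unfold interval_iffs; use assms r_def in smt)
qed

text \<open>Here the path visits the right vertex \<open>- s\<close>, between the left vertices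
  \<open>s\<close> and \<open>s + 1\<close>, with labels \<open>0\<close> and \<open>1\<close>. The
  cycle takes the right vertex \<open>s\<close> instead, reached with label \<open>6 * s\<close>,
  and closes with \<open>4 * s\<close>, the label that the path skips between \<open>2 * s\<close>
  and \<open>2 * s + 1\<close>.\<close>

lemma graceful_block_odd_special:
  assumes "0 < s" "K = 5 * s"
  shows "graceful_block K (nat (2 * s + 1))"
proof -
  have 1: "piece (True, 0) (False, 2 * s) {0} {2 * s} {2 * s}"
    by (rule piece_LR[OF piece_single]; simp)
  have 2: "piece (True, 1) (True, s) {1..s} {1..s - 1} {1 + 1..s + (s - 1)}"
    by (rule piece_rectangle; use assms in auto)
  have 3: "piece (True, 0) (True, s) {0..s} ({1..s - 1} \<union> {2 * s}) ({2..2 * s - 1} \<union>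
    {2 * s, 2 * s + 1})"
    by (rule piece_RL[OF 1 2]; unfold interval_iffs; use assms in smt)
  have 4: "piece (True, 0) (False, - s) {0..s} ({1..s - 1} \<union> {2 * s, - s}) ({0} \<union> {2..2 * s + 1})"
    by (rule piece_LR[OF 3 piece_single(2)]; unfold interval_iffs; use assms in smt)
  have 5: "piece (True, s + 1) (True, 2 * s) {s + 1..2 * s} {s + 1..2 * s - 1}
    {s + 1 + (s + 1)..2 * s + (2 * s - 1)}"
    by (rule piece_rectangle; use assms in auto)
  have 6: "piece (True, 0) (True, 2 * s) {0..2 * s} ({1..2 * s} - {s} \<union> {- s}) {0..4 * s - 1}"
    by (rule piece_RL[OF 4 5]; unfold interval_iffs; use assms in smt)
  have 7: "piece (False, 2 * s + 1) (False, 3 * s) {2 * s + 1..3 * s - 1} {2 * s + 1..3 * s}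
    {2 * s + 1 + (2 * s + 1)..3 * s - 1 + 3 * s}"
    by (rule piece_rectangle'; use assms in auto)
  have "piece (True, 0) (False, 3 * s) {0..3 * s - 1} ({1..3 * s} - {s} \<union> {- s}) ({0..6 * s - 1}
    - {4 * s})"
    by (rule piece_LR[OF 6 7]; unfold interval_iffs; use assms in smt)
  then have 8: "piece (True, 0) (False, K - 2 * s) {0..3 * s - 1} ({1..3 * s} - {s} \<union> {- s})
    ({0..6 * s - 1} - {4 * s})"
    using assms by simp
  have P: "piece (True, 0) (False, 0) ({0..3 * s - 1} \<union> {- K..- 1}) (({1..3 * s} - {s} \<union>
    {- s}) \<union> ({- K..0} - {- s}))
    (({0..6 * s - 1} - {4 * s}) \<union> {- 2 * K..- 1})"
    by (rule piece_append_outer[OF 8]; use assms in auto)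
  have 9: "piece (True, 3 * s) (True, K) {3 * s..K} {3 * s + 1..K} {3 * s + (3 * s + 1)..K + K}"
    by (rule piece_rectangle; use assms in simp)
  have C: "piece (True, 3 * s) (False, s) {3 * s..K} ({3 * s + 1..K} \<union> {s}) {6 * s..K + K}"
    by (rule piece_LR[OF 9 piece_single(2)]; unfold interval_iffs; use assms in smt)
  have "card {3 * s..K} = nat (2 * s + 1)"
    using assms by simp
  then show ?thesis
    by - (rule graceful_blockI[OF P C disjI1], assumption; unfold interval_iffs; use assms in smt)
qed

text \<open>The cycle occupies the middle labels \<open>{s..3 * s}\<close> and closes through
  \<open>- s\<close> with labels \<open>2 * s\<close> and \<open>0\<close>. The path jumps over it
  from the right vertex \<open>s\<close> to the left vertex \<open>5 * s + 1\<close>, with label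
  \<open>6 * s + 1\<close>.\<close>

lemma graceful_block_odd_large:
  assumes "0 < s" "5 * s < K"
  shows "graceful_block K (nat (2 * s + 1))"
proof -
  have 1: "piece (True, 0) (False, s) {0..s - 1} {1..s} {0 + 1..s - 1 + s}"
    by (rule piece_square; use assms in simp)
  have 2: "piece (True, 5 * s + 1) (False, K - 2 * s) {3 * s + 1..K} {3 * s + 1..K}
    {3 * s + 1 + (3 * s + 1)..K + K}"
    by (rule piece_square; use assms in simp)
  have 3: "piece (True, 0) (False, K - 2 * s) ({0..s - 1} \<union> {3 * s + 1..K}) ({1..s} \<union>
    {3 * s + 1..K})
    ({1..2 * s - 1} \<union> {6 * s + 1..2 * K})"
    by (rule piece_RL[OF 1 2]; unfold interval_iffs; use assms in smt)
  have P: "piece (True, 0) (False, 0) (({0..s - 1} \<union> {3 * s + 1..K}) \<union> {- K..- 1})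
    (({1..s} \<union> {3 * s + 1..K}) \<union> ({- K..0} - {- s}))
    (({1..2 * s - 1} \<union> {6 * s + 1..2 * K}) \<union> {- 2 * K..- 1})"
    by (rule piece_append_outer[OF 3]; use assms in auto)
  have 4: "piece (True, s) (True, 3 * s) {s..3 * s} {s + 1..3 * s} {s + (s + 1)..3 * s + 3 * s}"
    by (rule piece_rectangle; use assms in simp)
  have C: "piece (True, s) (False, - s) {s..3 * s} ({s + 1..3 * s} \<union> {- s}) {2 * s..3 * s + 3 * s}"
    by (rule piece_LR[OF 4 piece_single(2)]; unfold interval_iffs; use assms in smt)
  have "card {s..3 * s} = nat (2 * s + 1)"
    using assms by simp
  then show ?thesis
    by - (rule graceful_blockI[OF P C disjI1], assumption; unfold interval_iffs; use assms in smt)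
qed

section \<open>Blocks whose cycle has \<open>2 * h\<close> vertices in each class\<close>

text \<open>\<open>piece_append_outer\<close> applies with \<open>s = h\<close>. The cycle visits
  the right vertex \<open>- h\<close> between the left vertices \<open>h\<close> and
  \<open>h + 1\<close>, with labels \<open>0\<close> and \<open>1\<close>, and closes with
  \<open>2 * h\<close>.\<close>

lemma graceful_block_even_special:
  assumes "0 < h" "K = 4 * h"
  shows "graceful_block K (nat (2 * h))"
proof -
  have 1: "piece (False, K) (False, 2 * h) {2 * h + 1..K} {2 * h..K} {2 * h + 1 + 2 * h..K + K}"
    by (rule piece_rectangle'; use assms in auto)
  have 2: "piece (True, 0) (False, 2 * h) ({0} \<union> {2 * h + 1..K}) {2 * h..K} {4 * h..2 * K}"
    by (rule piece_LR[OF piece_single(1) 1]; unfold interval_iffs; use assms in smt)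
  then have 3: "piece (True, 0) (False, K - 2 * h) ({0} \<union> {2 * h + 1..K}) {2 * h..K} {4 * h..2 * K}"
    using assms by simp
  have P: "piece (True, 0) (False, 0) (({0} \<union> {2 * h + 1..K}) \<union> {- K..- 1}) ({2 * h..K}
    \<union> ({- K..0} - {- h}))
    ({4 * h..2 * K} \<union> {- 2 * K..- 1})"
    by (rule piece_append_outer[OF 3]; use assms in auto)
  have 4: "piece (True, 1) (True, h) {1..h} {1..h - 1} {1 + 1..h + (h - 1)}"
    by (rule piece_rectangle; use assms in auto)
  have 5: "piece (True, 1) (False, - h) {1..h} ({1..h - 1} \<union> {- h}) ({0} \<union> {2..2 * h - 1})"
    by (rule piece_LR[OF 4 piece_single(2)]; unfold interval_iffs; use assms in smt)
  have 6: "piece (True, h + 1) (False, 2 * h - 1) {h + 1..2 * h} {h..2 * h - 1}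
    {h + 1 + h..2 * h + (2 * h - 1)}"
    by (rule piece_square; use assms in simp)
  have C: "piece (True, 1) (False, 2 * h - 1) {1..2 * h} ({1..2 * h - 1} \<union> {- h})
    ({0..4 * h - 1} - {2 * h})"
    by (rule piece_RL[OF 5 6]; unfold interval_iffs; use assms in smt)
  have "card {1..2 * h} = nat (2 * h)"
    by simp
  then show ?thesis
    by - (rule graceful_blockI[OF P C disjI1], assumption; unfold interval_iffs; use assms in smt)
qed

text \<open>In the remaining even cases the cycle uses the smallest labels and omits the left vertex
  \<open>- h - k\<close>, which therefore has to be visited by the path.\<close>

lemma graceful_block_even_corner:
  assumes "0 < h" "0 < k"
    and P: "piece (True, 0) (False, 0) ({1 - k..k + 2 * h} \<union> {- h - k}) {- k..k + 2 * h}
      {- 2 * k..2 * k + 4 * h}"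
  shows "graceful_block (k + 2 * h) (nat (2 * h))"
proof -
  define K where "K = k + 2 * h"
  have 1: "piece (True, - K) (False, - K + h - 1) {- K..- K + h - 1} {- K..- K + h - 1}
    {- K + - K..- K + h - 1 + (- K + h - 1)}"
    by (rule piece_square; use assms in simp)
  have 2: "piece (True, - K + h + 1) (False, - k - 1) {- K + h + 1..- k} {- K + h..- k - 1}
    {- K + h + 1 + (- K + h)..- k + (- k - 1)}"
    by (rule piece_square; use assms in \<open>simp add: K_def\<close>)
  \<comment> \<open>Omitting the left vertex \<open>- h - k\<close> frees the label
    \<open>- K - k - 1\<close>, which is that of the closing edge from \<open>- k - 1\<close> to
    \<open>- K\<close>.\<close>
  have C: "piece (True, - K) (False, - k - 1) ({- K..- k} - {- h - k}) {- K..- k - 1}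
    ({- 2 * K..- 2 * k - 1} - {- K - k - 1})"
    by (rule piece_RL[OF 1 2]; unfold interval_iffs; use assms(1,2) K_def in smt)
  have "card {- K..- k - 1} = nat (2 * h)"
    by (simp add: K_def)
  then show ?thesis
    unfolding K_def[symmetric]
    by - (rule graceful_blockI[OF P C disjI2], assumption; unfold interval_iffs; use assms(1,2) K_def in smt)
qed

text \<open>In this and the next three lemmas the path leaves \<open>- h - k\<close> for the right
  vertex \<open>h - k\<close>, with the smallest label \<open>- 2 * k\<close>. Here it arrives from
  \<open>k + h\<close> with label \<open>0\<close>; the labels \<open>1\<close> to
  \<open>2 * (h - k)\<close> are kept for the final segment to the right vertex
  \<open>0\<close>.\<close>

lemma graceful_block_even_small:
  assumes "0 < k" "k \<le> h"
  shows "graceful_block (k + 2 * h) (nat (2 * h))"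
proof -
  have 1: "piece (True, 0) (False, - k) {1 - k..0} {- k..- 1} {1 - k + - k..0 + - 1}"
    by (rule piece_square; use assms in simp)
  have 2: "piece (True, 2 * h + 1 - k) (False, k + h) {h + 1 - k..k + 2 * h} {h + 1 - k..k + 2 * h}
    {h + 1 - k + (h + 1 - k)..k + 2 * h + (k + 2 * h)}"
    by (rule piece_square; use assms in simp)
  have 3: "piece (True, 0) (False, k + h) ({1 - k..0} \<union> {h + 1 - k..k + 2 * h}) ({- k..- 1}
    \<union> {h + 1 - k..k + 2 * h})
    ({1 - 2 * k..- 1} \<union> {2 * h + 1 - 2 * k..2 * k + 4 * h})"
    by (rule piece_RL[OF 1 2]; unfold interval_iffs; use assms in smt)
  have 4: "piece (True, 0) (True, - h - k) ({1 - k..0} \<union> {h + 1 - k..k + 2 * h} \<union> {- h - k})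
    ({- k..- 1} \<union> {h + 1 - k..k + 2 * h})
    ({1 - 2 * k..0} \<union> {2 * h + 1 - 2 * k..2 * k + 4 * h})"
    by (rule piece_RL[OF 3 piece_single(1)]; unfold interval_iffs; use assms in smt)
  have 5: "piece (False, h - k) (False, 0) {1..h - k} {0..h - k} {1 + 0..h - k + (h - k)}"
    by (rule piece_rectangle'; use assms in auto)
  have "piece (True, 0) (False, 0) ({1 - k..k + 2 * h} \<union> {- h - k}) {- k..k + 2 * h}
    {- 2 * k..2 * k + 4 * h}"
    by (rule piece_LR[OF 4 5]; unfold interval_iffs; use assms in smt)
  with assms show ?thesis by (intro graceful_block_even_corner) auto
qed

text \<open>The negative labels are split between a segment before the visit to
  \<open>- h - k\<close> and one after it. The edge into \<open>- h - k\<close> has the label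
  \<open>2 * (h - k) - 1\<close> just between them, and \<open>0\<close> is used on the way from
  \<open>k - h + 1\<close> to \<open>h - 1 - k\<close>. The bound on \<open>k\<close> keeps
  \<open>3 * k - 2 * h + 3\<close> in its interval.\<close>

lemma graceful_block_even_medium:
  assumes "h < k" "k \<le> 2 * h - 2"
  shows "graceful_block (k + 2 * h) (nat (2 * h))"
proof -
  have 1: "piece (True, 0) (True, k - h + 1) {0..k - h + 1} {1..k - h + 1} {0 + 1..k - h + 1 + (k - h + 1)}"
    by (rule piece_rectangle; use assms in auto)
  have 2: "piece (False, h - 1 - k) (False, - k) {1 - k..h - 1 - k} {- k..h - 1 - k}
    {1 - k + - k..h - 1 - k + (h - 1 - k)}"
    by (rule piece_rectangle'; use assms in auto)
  have 3: "piece (True, 0) (False, - k) ({0..k - h + 1} \<union> {1 - k..h - 1 - k}) ({1..k - h + 1}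
    \<union> {- k..h - 1 - k})
    ({0..2 * (k - h + 1)} \<union> {1 - 2 * k..2 * (h - 1 - k)})"
    by (rule piece_LR[OF 1 2]; unfold interval_iffs; use assms in smt)
  have 4: "piece (True, 3 * k - 2 * h + 3) (False, 3 * h - 1 - k) {k - h + 2..k + 2 * h} {k - h + 2..k + 2 * h}
    {k - h + 2 + (k - h + 2)..k + 2 * h + (k + 2 * h)}"
    by (rule piece_square; use assms in simp)
  have 5: "piece (True, 0) (False, 3 * h - 1 - k) ({0..k + 2 * h} \<union> {1 - k..h - 1 - k})
    ({1..k + 2 * h} \<union> {- k..h - 1 - k})
    ({0..2 * k + 4 * h} \<union> {1 - 2 * k..2 * (h - 1 - k)})"
    by (rule piece_RL[OF 3 4]; unfold interval_iffs; use assms in smt)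
  have 6: "piece (True, 0) (True, - h - k) ({0..k + 2 * h} \<union> {1 - k..h - 1 - k} \<union>
    {- h - k}) ({1..k + 2 * h} \<union> {- k..h - 1 - k})
    ({0..2 * k + 4 * h} \<union> {1 - 2 * k..2 * (h - k) - 1})"
    by (rule piece_RL[OF 5 piece_single(1)]; unfold interval_iffs; use assms in smt)
  have 7: "piece (False, h - k) (False, 0) {h - k..- 1} {h - k..0} {h - k + (h - k)..- 1 + 0}"
    by (rule piece_rectangle'; use assms in auto)
  have "piece (True, 0) (False, 0) ({1 - k..k + 2 * h} \<union> {- h - k}) {- k..k + 2 * h}
    {- 2 * k..2 * k + 4 * h}"
    by (rule piece_LR[OF 6 7]; unfold interval_iffs; use assms in smt)
  with assms show ?thesis by (intro graceful_block_even_corner) auto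
qed

text \<open>The first negative segment is now traversed in the opposite direction, entered directly
  from \<open>0\<close> with label \<open>- k\<close>. The label \<open>0\<close> becomes that of
  the edge into \<open>- h - k\<close>.\<close>

lemma graceful_block_even_medium':
  assumes "2 \<le> h" "k = 2 * h - 1"
  shows "graceful_block (k + 2 * h) (nat (2 * h))"
proof -
  have 1: "piece (False, - k) (False, h - 1 - k) {1 - k..h - 1 - k} {- k..h - 1 - k}
    {1 - k + - k..h - 1 - k + (h - 1 - k)}"
    by (rule piece_rectangle'; use assms in auto)
  have 2: "piece (True, 0) (False, h - 1 - k) ({0} \<union> {1 - k..h - 1 - k}) {- k..h - 1 - k}
    {1 - 2 * k..- k}"
    by (rule piece_LR[OF piece_single(1) 1]; unfold interval_iffs; use assms in smt)
  have 3: "piece (True, 3 * h - k) (False, 5 * h - 2 - k) {1..k + 2 * h} {1..k + 2 * h}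
    {1 + 1..k + 2 * h + (k + 2 * h)}"
    by (rule piece_square; use assms in simp)
  have 4: "piece (True, 0) (False, 5 * h - 2 - k) ({0..k + 2 * h} \<union> {1 - k..h - 1 - k})
    ({1..k + 2 * h} \<union> {- k..h - 1 - k})
    ({1..2 * k + 4 * h} \<union> {1 - 2 * k..- k})"
    by (rule piece_RL[OF 2 3]; unfold interval_iffs; use assms in smt)
  have 5: "piece (True, 0) (True, - h - k) ({0..k + 2 * h} \<union> {1 - k..h - 1 - k} \<union>
    {- h - k}) ({1..k + 2 * h} \<union> {- k..h - 1 - k})
    ({0..2 * k + 4 * h} \<union> {1 - 2 * k..- k})"
    by (rule piece_RL[OF 4 piece_single(1)]; unfold interval_iffs; use assms in smt)
  have 6: "piece (False, h - k) (False, 0) {h - k..- 1} {h - k..0} {h - k + (h - k)..- 1 + 0}"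
    by (rule piece_rectangle'; use assms in auto)
  have "piece (True, 0) (False, 0) ({1 - k..k + 2 * h} \<union> {- h - k}) {- k..k + 2 * h}
    {- 2 * k..2 * k + 4 * h}"
    by (rule piece_LR[OF 5 6]; unfold interval_iffs; use assms in smt)
  with assms show ?thesis by (intro graceful_block_even_corner) auto
qed

text \<open>The path reaches the right vertex \<open>0\<close> only in its last step, from the left
  vertex \<open>- 2 * h\<close>, whose label \<open>- 2 * h\<close> was skipped before. That
  \<open>- 2 * h\<close> is available in the last square needs \<open>2 * h < k\<close>.\<close>

lemma graceful_block_even_large:
  assumes "0 < h" "2 * h < k"
  shows "graceful_block (k + 2 * h) (nat (2 * h))"
proof -
  have 1: "piece (True, 0) (False, - h) {1 - h..0} {- h..- 1} {1 - h + - h..0 + - 1}"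
    by (rule piece_square; use assms in simp)
  have 2: "piece (True, h + 1) (False, k + h) {1..k + 2 * h} {1..k + 2 * h} {1 + 1..k + 2 * h + (k + 2 * h)}"
    by (rule piece_square; use assms in simp)
  have 3: "piece (True, 0) (False, k + h) {1 - h..k + 2 * h} ({- h..- 1} \<union> {1..k + 2 * h})
    ({1 - 2 * h..2 * k + 4 * h} - {0})"
    by (rule piece_RL[OF 1 2]; unfold interval_iffs; use assms in smt)
  have 4: "piece (True, 0) (True, - h - k) ({1 - h..k + 2 * h} \<union> {- h - k}) ({- h..- 1} \<union>
    {1..k + 2 * h})
    {1 - 2 * h..2 * k + 4 * h}"
    by (rule piece_RL[OF 3 piece_single(1)]; unfold interval_iffs; use assms in smt)
  have 5: "piece (False, h - k) (True, - 2 * h) {1 - k..- h} {- k..- h - 1} {1 - k + - k..- h + (- h - 1)}"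
    by (rule piece_square'; use assms in simp)
  have 6: "piece (True, 0) (True, - 2 * h) ({1 - k..k + 2 * h} \<union> {- h - k}) ({- k..k + 2 * h} - {0})
    ({- 2 * k..2 * k + 4 * h} - {- 2 * h})"
    by (rule piece_LR[OF 4 5]; unfold interval_iffs; use assms in smt)
  have "piece (True, 0) (False, 0) ({1 - k..k + 2 * h} \<union> {- h - k}) {- k..k + 2 * h}
    {- 2 * k..2 * k + 4 * h}"
    by (rule piece_LR[OF 6 piece_single(2)]; unfold interval_iffs; use assms in smt)
  with assms show ?thesis by (intro graceful_block_even_corner) auto
qed

text \<open>The isolated cases \<open>K = 5 * s\<close>, \<open>k = 2 * h - 1\<close> and
  \<open>k = 2 * h\<close> are thresholds at which a segment of either neighbouring construction
  would have an end outside its interval.\<close>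

lemma graceful_block_exists:
  assumes "2 \<le> j" "int j < K"
  shows "graceful_block K j"
proof (cases "even j")
  case True
  then obtain n where n: "j = 2 * n" by (elim evenE)
  define h k where "h = int n" and "k = K - 2 * h"
  have j: "j = nat (2 * h)" and K: "K = k + 2 * h" and h: "0 < h" "0 < k"
    using assms n by (auto simp: h_def k_def)
  consider "k \<le> h" | "h < k" "k \<le> 2 * h - 2" | "k = 2 * h - 1" "2 \<le> h" | "k = 2 * h" | "2 * h < k"
    using h by linarith
  then have "graceful_block (k + 2 * h) (nat (2 * h))"
  proof cases
    case 1
    then show ?thesis using graceful_block_even_small h by blast
  next
    case 2
    then show ?thesis using graceful_block_even_medium by blast
  next
    case 3
    then show ?thesis using graceful_block_even_medium' by blast
  next
    case 4
    then show ?thesis using graceful_block_even_special[of h "k + 2 * h"] h by simp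
  next
    case 5
    then show ?thesis using graceful_block_even_large h by blast
  qed
  then show ?thesis by (simp only: j K)
next
  case False
  then obtain n where n: "j = 2 * n + 1" by (elim oddE)
  define s where "s = int n"
  have j: "j = nat (2 * s + 1)" and s: "0 < s" "2 * s < K"
    using assms n by (auto simp: s_def)
  consider "K \<le> 3 * s" | "3 * s < K" "K < 5 * s" | "K = 5 * s" | "5 * s < K"
    by linarith
  then have "graceful_block K (nat (2 * s + 1))"
    by cases (use s graceful_block_odd_small graceful_block_odd_medium graceful_block_odd_special
      graceful_block_odd_large in blast)+
  then show ?thesis by (simp only: j)
qed

section \<open>Nesting the blocks\<close>

definition path_diffs :: "int list \<Rightarrow> int list" where
  "path_diffs ps = map (\<lambda>(x, y). \<bar>x - y\<bar>) (steps ps)"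

text \<open>A cycle of length two contributes its difference twice.\<close>

definition cycle_diffs :: "int list \<Rightarrow> int list" where
  "cycle_diffs c = \<bar>last c - hd c\<bar> # path_diffs c"

text \<open>A graceful labeling in list form. Absolute differences suffice because every edge
  contributes both signs; the values \<open>1, 3, 3\<close> stand in for
  \<open>1, 2, 3\<close>.\<close>

definition graceful_system :: "int \<Rightarrow> int list \<Rightarrow> int list list \<Rightarrow> bool" where
  "graceful_system N ps css \<longleftrightarrow> ps \<noteq> [] \<and> (\<forall>c\<in>set css. c
    \<noteq> []) \<and>
     distinct (ps @ concat css) \<and> set (ps @ concat css) = {0..N} \<and>
     mset (path_diffs ps @ concat (map cycle_diffs css)) = {#1, 3, 3#} + mset_set {4..N}"

lemma path_diffs_shift: "path_diffs (map (\<lambda>x. x + d) ps) = path_diffs ps"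
  by (auto simp: path_diffs_def steps_map)

lemma cycle_diffs_shift: "c \<noteq> [] \<Longrightarrow> cycle_diffs (map (\<lambda>x. x + d) c) =
  cycle_diffs c"
  by (simp add: cycle_diffs_def path_diffs_shift hd_map last_map)

lemma path_diffs_append:
  "p \<noteq> [] \<Longrightarrow> q \<noteq> [] \<Longrightarrow> path_diffs (p @ q) = path_diffs p @
    \<bar>last p - hd q\<bar> # path_diffs q"
  by (simp add: path_diffs_def steps_append)

lemma graceful_system_shift:
  assumes "graceful_system N ps css"
  shows "distinct (map (\<lambda>x. x + d) ps @ concat (map (map (\<lambda>x. x + d)) css))"
    and "set (map (\<lambda>x. x + d) ps @ concat (map (map (\<lambda>x. x + d)) css)) = {d..N + d}"
    and "concat (map cycle_diffs (map (map (\<lambda>x. x + d)) css)) = concat (map cycle_diffs css)"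
proof -
  have eq: "map (\<lambda>x. x + d) ps @ concat (map (map (\<lambda>x. x + d)) css) = map (\<lambda>x.
    x + d) (ps @ concat css)"
    by (simp add: map_concat)
  show "distinct (map (\<lambda>x. x + d) ps @ concat (map (map (\<lambda>x. x + d)) css))"
    using assms unfolding eq graceful_system_def by (subst distinct_map) (simp add: inj_on_def)
  have "set (ps @ concat css) = {0..N}"
    using assms by (simp add: graceful_system_def)
  then show "set (map (\<lambda>x. x + d) ps @ concat (map (map (\<lambda>x. x + d)) css)) = {d..N + d}"
    unfolding eq set_map by simp
  show "concat (map cycle_diffs (map (map (\<lambda>x. x + d)) css)) = concat (map cycle_diffs css)"
    using assms by (auto simp: graceful_system_def cycle_diffs_shift intro!: arg_cong[of _ _ concat])
qed

section \<open>The innermost system, with the 2-cycle\<close>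

lemma graceful_system_base_one: "graceful_system 3 [1, 2] [[0, 3]]"
proof -
  have "{0..3} = {0, 1, 2, 3 :: int}" by auto
  then show ?thesis
    by (auto simp: graceful_system_def path_diffs_def cycle_diffs_def)
qed

lemma graceful_system_base_four: "graceful_system 9 [4, 5, 1, 9, 0, 7, 2, 8] [[3, 6]]"
proof -
  have "{0..9} = {0, 1, 2, 3, 4, 5, 6, 7, 8, 9 :: int}" "{4..9} = {4, 5, 6, 7, 8, 9 :: int}"
    unfolding set_eq_iff atLeastAtMost_iff insert_iff empty_iff by presburger+
  then show ?thesis
    by (auto simp: graceful_system_def path_diffs_def cycle_diffs_def)
qed

text \<open>Two labels are added on either side. The old end becomes \<open>2 * K + 2\<close>, and
  the four appended edges have the differences \<open>2 * K + 2\<close>, \<open>2 * K + 5\<close>,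
  \<open>2 * K + 4\<close>, \<open>2 * K + 3\<close>. The new end again lies one below the largest
  label.\<close>

lemma graceful_system_base_step:
  assumes "graceful_system (2 * K + 1) ps [c]" "last ps = 2 * K" "1 \<le> K"
  shows "graceful_system (2 * (K + 2) + 1) (map (\<lambda>x. x + 2) ps @ [0, 2 * K + 5, 1, 2 * K + 4])
    [map (\<lambda>x. x + 2) c]"
proof -
  note sys = assms(1)[unfolded graceful_system_def]
  note sh = graceful_system_shift[OF assms(1), of 2]
  have ne: "ps \<noteq> []" using sys by simp
  have diffs: "path_diffs (map (\<lambda>x. x + 2) ps @ [0, 2 * K + 5, 1, 2 * K + 4]) =
      path_diffs ps @ [2 * K + 2, 2 * K + 5, 2 * K + 4, 2 * K + 3]"
    using ne assms(2,3) by (simp add: path_diffs_append path_diffs_shift last_map) (simp add: path_diffs_def)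
  have "{4..2 * K + 5} = {4..2 * K + 1} \<union> {2 * K + 2, 2 * K + 3, 2 * K + 4, 2 * K + 5}"
    using assms(3) by auto
  then have "mset_set {4..2 * K + 5} = mset_set {4..2 * K + 1} + {#2 * K + 2, 2 * K + 3, 2 * K + 4, 2 * K + 5#}"
    by (simp add: mset_set_Union)
  moreover have "{0..2 * K + 5} = {2..2 * K + 1 + 2} \<union> {0, 2 * K + 5, 1, 2 * K + 4}"
    using assms(3) by auto
  moreover have "distinct ((map (\<lambda>x. x + 2) ps @ concat [map (\<lambda>x. x + 2) c]) @ [0, 2 *
    K + 5, 1, 2 * K + 4])"
    using sh(1,2) assms(3) unfolding distinct_append[of "_ @ _"] by auto
  ultimately show ?thesis
    using sys sh assms(3) unfolding graceful_system_def diffs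
    by (simp add: add_ac Int_commute)
qed

text \<open>Steps of two start from \<open>1\<close> for odd \<open>n\<close> and from
  \<open>4\<close> for even \<open>n\<close>. The excluded value \<open>n = 2\<close> would belong
  to the maximum \<open>2\<close>.\<close>

lemma graceful_system_base:
  assumes "odd n \<or> 4 \<le> n"
  shows "\<exists>ps c. graceful_system (2 * int n + 1) ps [c] \<and> hd ps = int n \<and> last ps = 2
    * int n \<and> length c = 2"
  using assms
proof (induction n rule: less_induct)
  case (less n)
  have "n = 1 \<or> n = 4 \<or> (odd (n - 2) \<or> 4 \<le> n - 2) \<and> n = n - 2 + 2 \<and> 1 \<le> n - 2"
    using less.prems by presburger
  then consider "n = 1" | "n = 4" | "odd (n - 2) \<or> 4 \<le> n - 2" "n = n - 2 + 2" "1 \<le> n - 2"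
    by blast
  then show ?case
  proof cases
    case 1
    then show ?thesis
      using graceful_system_base_one by (intro exI[of _ "[1, 2]"] exI[of _ "[0, 3]"]) simp
  next
    case 2
    then show ?thesis
      using graceful_system_base_four
      by (intro exI[of _ "[4, 5, 1, 9, 0, 7, 2, 8]"] exI[of _ "[3, 6]"]) simp
  next
    case 3
    obtain ps c where IH: "graceful_system (2 * int (n - 2) + 1) ps [c]" "hd ps = int (n - 2)"
        "last ps = 2 * int (n - 2)" "length c = 2"
      using less.IH[of "n - 2"] 3 by auto
    have "ps \<noteq> []" using IH(1) by (simp add: graceful_system_def)
    moreover have "int n = int (n - 2) + 2" using 3 by simp
    ultimately show ?thesis
      using graceful_system_base_step[OF IH(1,3)] 3 IH
      by (intro exI[of _ "map (\<lambda>x. x + 2) ps @ [0, 2 * int (n - 2) + 5, 1, 2 * int (n - 2) + 4]"]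
          exI[of _ "map (\<lambda>x. x + 2) c"]) (auto simp: hd_map)
  qed
qed

text \<open>A block of width \<open>2 * K + 1\<close> is put around a smaller system. Its left class
  keeps its order, its right class is reversed. The path of the block ends at the offset
  \<open>K\<close> from the right, and from there it continues to the start of the inner path, at
  the offset \<open>K\<close> from the left.\<close>

lemma graceful_system_step:
  assumes sys: "graceful_system N ps css" and K: "hd ps = K" "0 \<le> K" and N: "3 \<le> N"
    and block: "graceful_block K j"
  shows "\<exists>ps' c. graceful_system (N + 2 * (2 * K + 1)) ps' (c # map (map (\<lambda>x. x + (2 *
    K + 1))) css) \<and>
    hd ps' = K \<and> last ps' = last ps + (2 * K + 1) \<and> length c = 2 * j"
proof -
  define w where "w = 2 * K + 1"
  define N' where "N' = N + 2 * w"
  \<comment> \<open>The difference of a left label \<open>K + a\<close> and a right label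
    \<open>N' - K - b\<close> is \<open>N' - 2 * K - (a + b)\<close>. So the sums in
    \<open>{-2 * K..2 * K}\<close> become the differences in \<open>{N + 2..N'}\<close>.\<close>
  define g where "g = (\<lambda>u :: bivertex. if fst u then K + snd u else N' - K - snd u)"
  obtain p c where p: "p \<noteq> []" "hd p = (True, 0)" "last p = (False, 0)" "bipartite_steps p"
    and c: "c \<noteq> []" "length c = 2 * j" "fst (hd c) \<noteq> fst (last c)" "bipartite_steps c"
    and pc: "distinct (p @ c)" "set (p @ c) = vertex_set {-K..K} {-K..K}"
      "distinct (step_sums p @ (snd (last c) + snd (hd c)) # step_sums c)"
      "set (step_sums p @ (snd (last c) + snd (hd c)) # step_sums c) = {-2 * K..2 * K}"
    using block unfolding graceful_block_def by blast
  note sh = graceful_system_shift[OF sys, of w]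
  have ne: "ps \<noteq> []" "\<forall>c\<in>set css. c \<noteq> []" using sys by (simp_all add:
    graceful_system_def)
  have range: "- K \<le> snd u \<and> snd u \<le> K" if "u \<in> set (p @ c)" for u
    using that unfolding pc(2) by (auto simp: vertex_set_def)
  have diff: "\<bar>g u - g v\<bar> = N' - 2 * K - (snd u + snd v)"
    if "u \<in> set (p @ c)" "v \<in> set (p @ c)" "fst u \<noteq> fst v" for u v
    using range[OF that(1)] range[OF that(2)] that(3) N K(2)
    unfolding g_def N'_def w_def by (cases "fst u"; cases "fst v") auto
  have diffs: "path_diffs (map g q) = map (\<lambda>s. N' - 2 * K - s) (step_sums q)"
    if "set q \<subseteq> set (p @ c)" "bipartite_steps q" for q
    unfolding path_diffs_def step_sums_def steps_map map_map
  proof (rule map_cong[OF refl])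
    fix x assume x: "x \<in> set (steps q)"
    obtain u v where uv: "x = (u, v)" by (cases x)
    show "((\<lambda>(x, y). \<bar>x - y\<bar>) \<circ> map_prod g g) x = ((\<lambda>s. N' - 2 * K - s)
      \<circ> (\<lambda>(u, v). snd u + snd v)) x"
      using diff[of u v] set_steps[of u v q] x that unfolding uv bipartite_steps_def by auto
  qed
  have cyc: "cycle_diffs (map g c) = map (\<lambda>s. N' - 2 * K - s) ((snd (last c) + snd (hd c)) #
    step_sums c)"
    unfolding cycle_diffs_def using diffs[of c] diff[of "last c" "hd c"] c
    by (simp add: last_map hd_map)
  define ps' where "ps' = map g p @ map (\<lambda>x. x + w) ps"
  define css' where "css' = map g c # map (map (\<lambda>x. x + w)) css"
  \<comment> \<open>The linking edge runs from \<open>N' - K\<close> to \<open>K + w\<close>. Its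
    difference \<open>N + 1\<close> fills the gap between the inner differences and those of the
    block.\<close>
  have path: "path_diffs ps' = map (\<lambda>s. N' - 2 * K - s) (step_sums p) @ (N + 1) # path_diffs ps"
    unfolding ps'_def using p ne diffs[of p] K N
    by (simp add: path_diffs_append path_diffs_shift last_map hd_map) (simp add: g_def N'_def w_def)
  have inj: "inj_on g (set (p @ c))"
  proof (rule inj_onI)
    fix u v assume "u \<in> set (p @ c)" "v \<in> set (p @ c)" "g u = g v"
    then show "u = v"
      using range[of u] range[of v] N K(2) unfolding g_def N'_def w_def
      by (cases "fst u"; cases "fst v") (auto simp: prod_eq_iff)
  qed
  have image: "g ` set (p @ c) = {0..2 * K} \<union> {N' - 2 * K..N'}"
  proof -
    have "g ` ({True} \<times> X) = (\<lambda>a. K + a) ` X" "g ` ({False} \<times> X) = (\<lambda>b.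
      (N' - K) - b) ` X" for X
    proof -
      have "{b} \<times> X = Pair b ` X" for b :: bool by auto
      then show "g ` ({True} \<times> X) = (\<lambda>a. K + a) ` X" "g ` ({False} \<times> X) =
      (\<lambda>b. (N' - K) - b) ` X"
        by (simp_all only: image_image g_def fst_conv snd_conv if_True if_False)
    qed
    then have "g ` set (p @ c) = (\<lambda>a. K + a) ` {- K..K} \<union> (\<lambda>b. (N' - K) - b) ` {- K..K}"
      unfolding pc(2) vertex_set_def image_Un by simp
    also have "\<dots> = {0..2 * K} \<union> {N' - 2 * K..N'}"
      by simp
    finally show ?thesis .
  qed
  \<comment> \<open>The block and the inner system are interleaved in
    \<open>ps' @ concat css'\<close>, so distinctness is transferred through the multiset.\<close>
  have perm: "mset (ps' @ concat css') = mset (map g (p @ c)) + mset (map (\<lambda>x. x + w) ps @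
    concat (map (map (\<lambda>x. x + w)) css))"
    unfolding ps'_def css'_def by simp
  have "set (map g (p @ c)) \<inter> {w..N + w} = {}"
    unfolding set_map image by (auto simp: w_def N'_def)
  then have dist: "distinct (map g (p @ c) @ (map (\<lambda>x. x + w) ps @ concat (map (map
    (\<lambda>x. x + w)) css)))"
    using sh(1,2) pc(1) inj by (simp only: distinct_append distinct_map)
  have "set (ps' @ concat css') = set (map g (p @ c)) \<union> set (map (\<lambda>x. x + w) ps @ concat
    (map (map (\<lambda>x. x + w)) css))"
    unfolding ps'_def css'_def by auto
  also have "\<dots> = {0..N'}"
    unfolding sh(2) set_map image using N K(2) by (auto simp: w_def N'_def)
  finally have set': "set (ps' @ concat css') = {0..N'}" .
  have "mset (path_diffs ps' @ concat (map cycle_diffs css')) =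
      image_mset (\<lambda>s. N' - 2 * K - s) (mset (step_sums p @ (snd (last c) + snd (hd c)) # step_sums c)) +
      {#N + 1#} + mset (path_diffs ps @ concat (map cycle_diffs css))"
    unfolding path css'_def using sh(3) cyc by simp
  also have "mset (step_sums p @ (snd (last c) + snd (hd c)) # step_sums c) = mset_set {-2 * K..2 * K}"
    using pc(3,4) by (metis mset_set_set)
  also have "image_mset (\<lambda>s. N' - 2 * K - s) (mset_set {-2 * K..2 * K}) = mset_set {N + 2..N'}"
    by (subst image_mset_mset_set) (auto simp: inj_on_def N'_def w_def)
  also have "mset (path_diffs ps @ concat (map cycle_diffs css)) = {#1, 3, 3#} + mset_set {4..N}"
    using sys by (simp add: graceful_system_def)
  also have "mset_set {N + 2..N'} + {#N + 1#} + ({#1, 3, 3#} + mset_set {4..N}) = {#1, 3, 3#} +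
    mset_set {4..N'}"
  proof -
    have "{4..N'} = {4..N} \<union> ({N + 1} \<union> {N + 2..N'})"
      using N K(2) by (auto simp: N'_def w_def)
    then have "mset_set {4..N'} = mset_set {4..N} + ({#N + 1#} + mset_set {N + 2..N'})"
      by (simp add: mset_set_Union)
    then show ?thesis by simp
  qed
  finally have "mset (path_diffs ps' @ concat (map cycle_diffs css')) = {#1, 3, 3#} + mset_set {4..N'}" .
  moreover have "distinct (ps' @ concat css')"
    using dist perm by (metis mset_append mset_eq_imp_distinct_iff)
  ultimately have "graceful_system N' ps' css'"
    unfolding graceful_system_def using set' ne c(1) by (auto simp: ps'_def css'_def)
  moreover have "hd ps' = K" "last ps' = last ps + w"
    using p ne by (simp_all add: ps'_def g_def hd_map last_map)
  ultimately show ?thesis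
    using c(2) unfolding css'_def N'_def w_def by (intro exI[of _ ps'] exI[of _ "map g c"]) simp
qed

text \<open>Each step wraps one more block around the system, so the head of \<open>ls\<close> is
  outermost and the 2-cycle comes last. A length \<open>l = 2 * j\<close> with
  \<open>2 < l < 2 * n\<close> gives \<open>2 \<le> j < n\<close>, as the block requires.\<close>

lemma graceful_system_exists:
  assumes "odd n \<or> 4 \<le> n" and "\<And>l. l \<in> set ls \<Longrightarrow> even l \<and> 2 < l
    \<and> l < 2 * n"
  shows "\<exists>ps css. graceful_system ((2 * int (length ls) + 1) * (2 * int n + 1)) ps css \<and>
    hd ps = int n \<and>
     last ps = int (length ls) * (2 * int n + 1) + 2 * int n \<and> map length css = ls @ [2]"
  using assms(2)
proof (induction ls)
  case Nil
  obtain ps c where "graceful_system (2 * int n + 1) ps [c]" "hd ps = int n" "last ps = 2 * int n"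
    "length c = 2"
    using graceful_system_base[OF assms(1)] by blast
  then show ?case by (intro exI[of _ ps] exI[of _ "[c]"]) simp
next
  case (Cons l ls)
  obtain ps css where IH: "graceful_system ((2 * int (length ls) + 1) * (2 * int n + 1)) ps css" "hd ps = int n"
      "last ps = int (length ls) * (2 * int n + 1) + 2 * int n" "map length css = ls @ [2]"
    using Cons by auto
  obtain j where j: "l = 2 * j" using Cons.prems[of l] by (auto elim: evenE)
  have block: "graceful_block (int n) j"
    by (rule graceful_block_exists) (use Cons.prems[of l] j in auto)
  have size: "3 \<le> (2 * int (length ls) + 1) * (2 * int n + 1)"
  proof -
    have "1 \<le> n" using assms(1) by (cases n) auto
    then have "1 * 3 \<le> (2 * int (length ls) + 1) * (2 * int n + 1)"
      by (intro mult_mono) auto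
    then show ?thesis by simp
  qed
  obtain ps' c where "graceful_system ((2 * int (length ls) + 1) * (2 * int n + 1) + 2 * (2 * int n + 1)) ps'
      (c # map (map (\<lambda>x. x + (2 * int n + 1))) css)" "hd ps' = int n" "last ps' = last ps + (2
      * int n + 1)" "length c = 2 * j"
    using graceful_system_step[OF IH(1,2) of_nat_0_le_iff size block] by blast
  then show ?case
    using IH j by (intro exI[of _ ps'] exI[of _ "c # map (map (\<lambda>x. x + (2 * int n + 1))) css"])
      (simp add: algebra_simps comp_def)
qed

section \<open>From lists of labels to graphs\<close>

text \<open>Mirrors the component index \<open>Some (l, k)\<close> of
  \<open>cycles_path\<close>.\<close>

definition nth_cycle :: "int list list \<Rightarrow> nat \<Rightarrow> nat \<Rightarrow> int list" where
  "nth_cycle css l k = filter (\<lambda>c. length c = l) css ! k"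

definition placement :: "int list \<Rightarrow> int list list \<Rightarrow> (nat \<times> nat) option
  \<times> nat \<Rightarrow> int" where
  "placement ps css x = (case x of (None, v) \<Rightarrow> ps ! v | (Some (l, k), v) \<Rightarrow>
    nth_cycle css l k ! v)"

abbreviation cycle_index :: "nat multiset \<Rightarrow> (nat \<times> nat) set" where
  "cycle_index L \<equiv> SIGMA l:set_mset L. {0..<count L l}"

lemma count_lengths: "count (mset (map length css)) l = length (filter (\<lambda>c. length c = l) css)"
  by (induction css) auto

lemma nth_cycle:
  assumes "(l, k) \<in> cycle_index (mset (map length css))"
  shows "nth_cycle css l k \<in> set css" "length (nth_cycle css l k) = l"
proof -
  have "k < length (filter (\<lambda>c. length c = l) css)"
    using assms by (simp add: count_lengths flip: mset_map)
  then have "nth_cycle css l k \<in> set (filter (\<lambda>c. length c = l) css)"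
    unfolding nth_cycle_def by (rule nth_mem)
  then show "nth_cycle css l k \<in> set css" "length (nth_cycle css l k) = l" by auto
qed

lemma nth_cycle_surj:
  assumes "c \<in> set css"
  shows "\<exists>k. (length c, k) \<in> cycle_index (mset (map length css)) \<and> nth_cycle css
    (length c) k = c"
proof -
  have "c \<in> set (filter (\<lambda>d. length d = length c) css)" using assms by simp
  then obtain k where k: "k < length (filter (\<lambda>d. length d = length c) css)"
      "filter (\<lambda>d. length d = length c) css ! k = c"
    by (metis in_set_conv_nth)
  then show ?thesis
    using assms by (intro exI[of _ k]) (auto simp: nth_cycle_def count_lengths simp flip: mset_map)
qed

lemma sum_list_by_length:
  fixes h :: "'a list \<Rightarrow> 'b :: comm_monoid_add"
  assumes "finite F" "length ` set css \<subseteq> F"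
  shows "(\<Sum>l\<in>F. sum_list (map h (filter (\<lambda>c. length c = l) css))) = sum_list (map h css)"
  using assms(2)
proof (induction css)
  case (Cons c css)
  have "(\<Sum>l\<in>F. sum_list (map h (filter (\<lambda>c. length c = l) (c # css)))) =
      (\<Sum>l\<in>F. (if l = length c then h c else 0) + sum_list (map h (filter (\<lambda>c. length c
      = l) css)))"
    by (intro sum.cong) auto
  then show ?case
    using Cons assms(1) by (simp add: sum.distrib)
qed simp

text \<open>Grouping \<open>css\<close> by length meets every position of the list exactly once, so
  sums over component indices become sums over the list.\<close>

lemma sum_nth_cycle:
  fixes h :: "int list \<Rightarrow> 'b :: comm_monoid_add"
  shows "(\<Sum>(l, k)\<in>cycle_index (mset (map length css)). h (nth_cycle css l k)) = sum_list (map h css)"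
proof -
  have inner: "(\<Sum>k\<in>{0..<count (mset (map length css)) l}. h (nth_cycle css l k)) =
      sum_list (map h (filter (\<lambda>c. length c = l) css))" for l
    unfolding count_lengths nth_cycle_def by (subst sum_list_sum_nth) simp
  have "(\<Sum>(l, k)\<in>cycle_index (mset (map length css)). h (nth_cycle css l k)) =
      (\<Sum>l\<in>set_mset (mset (map length css)). \<Sum>k\<in>{0..<count (mset (map length css)) l}.
      h (nth_cycle css l k))"
    by (subst sum.Sigma) auto
  also have "\<dots> = sum_list (map h css)"
    unfolding inner by (rule sum_list_by_length) auto
  finally show ?thesis .
qed

section \<open>Differences of the labeled graph\<close>

definition edge_differences :: "int set \<Rightarrow> int multiset" where
  "edge_differences e = image_mset (\<lambda>(a, b). a - b) (mset_set {(a, b). e = {a, b}})"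

lemma edge_differences: "a \<noteq> b \<Longrightarrow> edge_differences {a, b} = plus_minus
  {#\<bar>a - b\<bar>#}"
proof -
  assume ab: "a \<noteq> b"
  have "{(x, y). {a, b} = {x, y}} = {(a, b), (b, a)}"
    by (auto simp: doubleton_eq_iff)
  then show ?thesis
    using ab by (simp add: edge_differences_def plus_minus_def abs_if)
qed

lemma plus_minus_add: "plus_minus (A + B) = plus_minus A + plus_minus B"
  by (simp add: plus_minus_def)

lemma plus_minus_empty: "plus_minus {#} = {#}"
  by (simp add: plus_minus_def)

lemma differences_path:
  assumes "distinct ps" "ps \<noteq> []"
  shows "(\<Sum>e\<in>#edges (path_graph (length ps - 1)). edge_differences ((!) ps ` e)) = plus_minus
    (mset (path_diffs ps))"
proof -
  have *: "(\<Sum>e\<in>#mset (map (\<lambda>(x, y). {x, y}) (steps ps)). edge_differences e) =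
    plus_minus (mset (path_diffs ps))"
    using assms(1)
  proof (induction ps rule: induct_list012)
    case (3 x y ps)
    then show ?case
      by (simp add: path_diffs_def edge_differences plus_minus_def)
  qed (simp_all add: path_diffs_def plus_minus_empty)
  have "steps ps = map (\<lambda>i. (ps ! i, ps ! Suc i)) [0..<length ps - 1]"
    by (rule nth_equalityI) (auto simp: steps_def nth_tl)
  then show ?thesis
    unfolding *[symmetric] path_graph_def by (simp add: image_mset.compositionality comp_def)
qed

text \<open>The edge with index \<open>n\<close> wraps around to \<open>0\<close>; without it the
  cycle is the path on the same vertices. For length two the closing edge is parallel to the path
  edge and counts a second time.\<close>

lemma differences_cycle:
  assumes "distinct c" "2 \<le> length c"
  shows "(\<Sum>e\<in>#edges (cycle_graph (length c)). edge_differences ((!) c ` e)) = plus_minus (mset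
    (cycle_diffs c))"
proof -
  define n where "n = length c - 1"
  have n: "length c = Suc n" "1 \<le> n" and "c \<noteq> []" using assms by (auto simp: n_def)
  have ends: "hd c = c ! 0" "last c = c ! n"
    using assms(2) by (cases c; simp add: n_def last_conv_nth)+
  have ne: "last c \<noteq> hd c"
    unfolding ends using assms(1) n by (simp add: nth_eq_iff_index_eq)
  have "edges (cycle_graph (length c)) = add_mset {n, 0} (image_mset (\<lambda>i. {i, Suc i mod Suc n})
    (mset_set {0..<n}))"
    by (simp add: cycle_graph_def n(1) atLeast0_lessThan_Suc)
  also have "image_mset (\<lambda>i. {i, Suc i mod Suc n}) (mset_set {0..<n}) = edges (path_graph n)"
    unfolding path_graph_def by (auto intro!: image_mset_cong)
  finally have "(\<Sum>e\<in>#edges (cycle_graph (length c)). edge_differences ((!) c ` e)) =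
      edge_differences {last c, hd c} + (\<Sum>e\<in>#edges (path_graph n). edge_differences ((!) c ` e))"
    by (simp add: ends)
  also have "\<dots> = plus_minus {#\<bar>last c - hd c\<bar>#} + plus_minus (mset (path_diffs c))"
    using differences_path[of c] \<open>c \<noteq> []\<close> assms ne by (simp add: edge_differences n_def)
  finally show ?thesis
    by (simp add: cycle_diffs_def plus_minus_def)
qed

lemma sum_mset_edges_sum:
  "finite I \<Longrightarrow> (\<Sum>e\<in>#(\<Sum>i\<in>I. M i). h e) = (\<Sum>i\<in>I. \<Sum>e\<in>#M i. h e)"
  for h :: "'a \<Rightarrow> 'b :: comm_monoid_add"
  by (induction I rule: finite_induct) auto

lemma edges_cycles_path_sum:
  fixes h :: "((nat \<times> nat) option \<times> nat) set \<Rightarrow> 'b :: comm_monoid_add"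
  shows "(\<Sum>e\<in>#edges (cycles_path L m). h e) = (\<Sum>e\<in>#edges (path_graph m). h (Pair None ` e)) +
    (\<Sum>(l, k)\<in>cycle_index L. \<Sum>e\<in>#edges (cycle_graph l). h (Pair (Some (l, k)) ` e))"
  unfolding cycles_path_def disjoint_union_graph_def
  by (simp add: sum_mset_edges_sum sum.reindex image_mset.compositionality comp_def case_prod_unfold image_iff)

lemma verts_cycles_path:
  "verts (cycles_path L m) = Pair None ` {0..m} \<union> (\<Union>(l, k)\<in>cycle_index L. Pair (Some
    (l, k)) ` {0..<l})"
  by (auto simp: cycles_path_def disjoint_union_graph_def path_graph_def cycle_graph_def)

lemma card_verts_cycles_path: "card (verts (cycles_path L m)) = m + 1 + \<Sum>\<^sub># L"
proof -
  have "card (verts (cycles_path L m)) = m + 1 + (\<Sum>(l, k)\<in>cycle_index L. l)"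
    unfolding cycles_path_def disjoint_union_graph_def
    by (simp add: sum.reindex path_graph_def cycle_graph_def case_prod_unfold image_iff)
  also have "(\<Sum>(l, k)\<in>cycle_index L. l) = (\<Sum>l\<in>set_mset L. \<Sum>k\<in>{0..<count L l}. l)"
    by (subst sum.Sigma) auto
  finally show ?thesis by (simp add: sum_mset_count)
qed

text \<open>\<open>placement\<close> maps the vertices onto \<open>{0..N}\<close>, and the two sets
  have the same size, so injectivity follows by counting.\<close>

lemma graceful_system_imp_labeling:
  assumes sys: "graceful_system N ps css" and L: "mset (map length css) = L" "count L 2 = 1"
    "\<forall>l\<in>#L. 2 \<le> l"
  shows "\<exists>\<Gamma>. graceful_labeling L (length ps - 1) (hd ps) (last ps) \<Gamma>"
proof -
  define m where "m = length ps - 1"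
  define f where "f = placement ps css"
  define \<Gamma> where "\<Gamma> = \<lparr> verts = {0..N}, edges = image_mset (image f) (edges
    (cycles_path L m)) \<rparr>"
  have ps: "ps \<noteq> []" "distinct ps" and dist: "distinct (ps @ concat css)"
    and set: "set (ps @ concat css) = {0..N}"
    and diffs: "mset (path_diffs ps @ concat (map cycle_diffs css)) = {#1, 3, 3#} + mset_set {4..N}"
    using sys by (auto simp: graceful_system_def)
  have f_None: "f (None, v) = ps ! v" and f_Some: "f (Some i, v) = nth_cycle css (fst i) (snd i) ! v" for i v
    by (simp_all add: f_def placement_def case_prod_unfold)
  have "int (length (ps @ concat css)) = N + 1"
  proof -
    have "hd ps \<in> {0..N}" unfolding set[symmetric] using ps(1) by simp
    moreover have "length (ps @ concat css) = card {0..N}"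
      using dist unfolding set[symmetric] by (rule distinct_card[symmetric])
    ultimately show ?thesis by simp
  qed
  moreover have "length (concat css) = \<Sum>\<^sub># L"
    unfolding L(1)[symmetric] by (simp add: length_concat sum_mset_sum_list flip: mset_map)
  \<comment> \<open>A path has one vertex more than it has edges, a cycle equally many, so
    \<open>N + 1\<close> labels mean \<open>N\<close> edges.\<close>
  ultimately have N: "N = int (\<Sum>\<^sub># L + m)"
    using ps(1) by (cases ps) (auto simp: m_def)
  have cycle: "nth_cycle css l k \<in> set css" "length (nth_cycle css l k) = l" if "(l, k) \<in>
    cycle_index L" for l k
    using nth_cycle[of l k css] that unfolding L(1) by blast+
  have image: "f ` verts (cycles_path L m) = {0..N}"
  proof -
    have "(\<lambda>v. ps ! v) ` {0..m} = set ps"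
    proof -
      have "{0..m} = {0..<length ps}" using ps(1) by (cases ps) (auto simp: m_def)
      then show ?thesis using nth_image[of "length ps" ps] by simp
    qed
    moreover have "(\<Union>(l, k)\<in>cycle_index L. (\<lambda>v. nth_cycle css l k ! v) ` {0..<l}) =
      set (concat css)"
    proof -
      have "(\<lambda>v. nth_cycle css l k ! v) ` {0..<l} = set (nth_cycle css l k)" if "(l, k) \<in>
      cycle_index L" for l k
        using nth_image[of l "nth_cycle css l k"] cycle(2)[OF that] by simp
      then have "(\<Union>(l, k)\<in>cycle_index L. (\<lambda>v. nth_cycle css l k ! v) ` {0..<l}) =
          (\<Union>(l, k)\<in>cycle_index L. set (nth_cycle css l k))"
        by (intro SUP_cong refl) (simp only: split_paired_all case_prod_conv)
      also have "\<dots> = \<Union> (set ` set css)"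
      proof (intro set_eqI iffI)
        fix x assume "x \<in> \<Union> (set ` set css)"
        then obtain c where "c \<in> set css" "x \<in> set c" by blast
        then show "x \<in> (\<Union>(l, k)\<in>cycle_index L. set (nth_cycle css l k))"
          using nth_cycle_surj[of c css] unfolding L(1) by force
      qed (use cycle(1) in blast)
      finally show ?thesis by simp
    qed
    ultimately show ?thesis
      unfolding verts_cycles_path set[symmetric] set_append
      by (simp add: image_Un image_UN image_image f_None f_Some case_prod_unfold)
  qed
  have "finite (verts (cycles_path L m))"
    unfolding verts_cycles_path by auto
  moreover have "card (f ` verts (cycles_path L m)) = card (verts (cycles_path L m))"
  proof -
    have "N + 1 = int (m + 1 + \<Sum>\<^sub># L)" unfolding N by simp
    then show ?thesis
      by (simp only: image card_verts_cycles_path card_atLeastAtMost_int diff_zero nat_int)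
  qed
  ultimately have "bij_betw f (verts (cycles_path L m)) {0..N}"
    unfolding bij_betw_def using image by (simp add: eq_card_imp_inj_on)
  then have iso: "multigraph_iso f (cycles_path L m) \<Gamma>"
    by (simp add: multigraph_iso_def \<Gamma>_def)
  have "differences \<Gamma> = (\<Sum>e\<in>#edges (cycles_path L m). edge_differences (f ` e))"
    by (simp add: differences_def \<Gamma>_def edge_differences_def image_mset.compositionality comp_def)
  also have "\<dots> = (\<Sum>e\<in>#edges (path_graph m). edge_differences ((!) ps ` e)) +
      (\<Sum>(l, k)\<in>cycle_index L. \<Sum>e\<in>#edges (cycle_graph l). edge_differences ((!)
      (nth_cycle css l k) ` e))"
    unfolding edges_cycles_path_sum by (simp add: image_image f_None f_Some case_prod_unfold)
  also have "(\<Sum>e\<in>#edges (path_graph m). edge_differences ((!) ps ` e)) = plus_minus (mset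
    (path_diffs ps))"
    unfolding m_def by (rule differences_path) (use ps in auto)
  also have "(\<Sum>(l, k)\<in>cycle_index L. \<Sum>e\<in>#edges (cycle_graph l). edge_differences ((!)
    (nth_cycle css l k) ` e)) =
      (\<Sum>(l, k)\<in>cycle_index L. plus_minus (mset (cycle_diffs (nth_cycle css l k))))"
  proof (intro sum.cong refl, clarify)
    fix l k assume "l \<in># L" "k \<in> {0..<count L l}"
    then have lk: "(l, k) \<in> cycle_index L" by simp
    have "distinct (nth_cycle css l k)"
      using dist cycle(1)[OF lk] by (simp add: distinct_concat_iff)
    then show "(\<Sum>e\<in>#edges (cycle_graph l). edge_differences ((!) (nth_cycle css l k) ` e)) =
        plus_minus (mset (cycle_diffs (nth_cycle css l k)))"
      using differences_cycle[of "nth_cycle css l k"] cycle(2)[OF lk] L(3) \<open>l \<in># L\<close> by simp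
  qed
  also have "\<dots> = sum_list (map (\<lambda>c. plus_minus (mset (cycle_diffs c))) css)"
    using sum_nth_cycle[of "\<lambda>c. plus_minus (mset (cycle_diffs c))" css] unfolding L(1) .
  also have "\<dots> = plus_minus (mset (concat (map cycle_diffs css)))"
    by (induction css) (auto simp: plus_minus_add plus_minus_empty)
  finally have "differences \<Gamma> = plus_minus {#1, 3, 3#} + plus_minus (mset_set {4..N})"
    using diffs by (simp flip: plus_minus_add)
  moreover have "f (None, 0) = hd ps" "f (None, m) = last ps"
    using ps(1) by (simp_all add: f_None m_def hd_conv_nth last_conv_nth)
  ultimately have "graceful_labeling L m (hd ps) (last ps) \<Gamma>"
    unfolding graceful_labeling_def Let_def size_edges_cycles_path N[symmetric]
    using L iso by (auto simp: \<Gamma>_def)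
  then show ?thesis unfolding m_def by blast
qed

theorem theorem5p1:
  fixes L :: "nat multiset" and \<epsilon> :: nat
  assumes "\<And>l. l \<in># L \<Longrightarrow> even l \<and> l > 2"
    and "\<epsilon> = (2 * size L + 1) * (max_mset L + 3)"
  shows "\<exists>\<Gamma>. graceful_labeling (add_mset 2 L) (\<epsilon> - \<Sum>\<^sub># L - 2)
           (int (max_mset L div 2 + 1)) (int ((size L + 1) * (max_mset L + 3)) - 1) \<Gamma>"
proof -
  define n where "n = max_mset L div 2 + 1"
  obtain ls where ls: "mset ls = L" using ex_mset by blast
  have max: "l \<le> max_mset L" if "l \<in># L" for l
    using that by (auto simp: max_mset_def)
  \<comment> \<open>The maximum is never \<open>2\<close>, which excludes \<open>n = 2\<close>; an
    empty \<open>L\<close> gives \<open>n = 1\<close>.\<close>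
  have "even (max_mset L) \<and> (max_mset L = 0 \<or> 2 < max_mset L)"
  proof (cases "L = {#}")
    case False
    then have "max_mset L \<in># L" by (simp add: max_mset_def Max_in)
    then show ?thesis using assms(1) by blast
  qed (simp add: max_mset_def)
  then have M: "max_mset L + 3 = 2 * n + 1" and n: "odd n \<or> 4 \<le> n"
    unfolding n_def by presburger+
  have "even l \<and> 2 < l \<and> l < 2 * n" if "l \<in> set ls" for l
    using that assms(1)[of l] max[of l] M ls by auto
  then obtain ps css where sys: "graceful_system ((2 * int (length ls) + 1) * (2 * int n + 1)) ps css"
      "hd ps = int n" "last ps = int (length ls) * (2 * int n + 1) + 2 * int n" "map length css = ls @ [2]"
    using graceful_system_exists[OF n, of ls] by blast
  have len: "length ls = size L" using ls by auto
  have lengths: "mset (map length css) = add_mset 2 L"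
    using sys(4) ls by simp
  have "2 \<notin># L" using assms(1)[of 2] by auto
  then have count: "count (add_mset 2 L) 2 = 1" by (simp add: not_in_iff)
  have ge: "\<forall>l\<in>#add_mset 2 L. 2 \<le> l" using assms(1) by fastforce
  obtain \<Gamma> where \<Gamma>: "graceful_labeling (add_mset 2 L) (length ps - 1) (hd ps) (last ps) \<Gamma>"
    using graceful_system_imp_labeling[OF sys(1) lengths count ge] by blast
  \<comment> \<open>The path carries the \<open>\<epsilon> + 1\<close> labels that are left over by
    the cycles, including the two labels of the 2-cycle.\<close>
  have "length ps - 1 = \<epsilon> - \<Sum>\<^sub># L - 2"
  proof -
    have "ps \<noteq> []" "distinct (ps @ concat css)" "set (ps @ concat css) =
      {0..(2 * int (length ls) + 1) * (2 * int n + 1)}"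
      using sys(1) by (simp_all add: graceful_system_def)
    then have "length (ps @ concat css) = nat ((2 * int (length ls) + 1) * (2 * int n + 1) + 1)"
      by (metis card_atLeastAtMost_int diff_zero distinct_card)
    moreover have "(2 * int (length ls) + 1) * (2 * int n + 1) + 1 = int (\<epsilon> + 1)"
      unfolding assms(2) M len by (simp add: algebra_simps)
    moreover have "length (concat css) = \<Sum>\<^sub># L + 2"
      using sys(4) ls by (simp add: length_concat sum_mset_sum_list flip: ls)
    ultimately show ?thesis by simp
  qed
  moreover have "last ps = int ((size L + 1) * (max_mset L + 3)) - 1"
    unfolding sys(3) M len by (simp add: algebra_simps)
  ultimately show ?thesis
    using \<Gamma> sys(2) by (auto simp: n_def)
qed

end
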